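(* Let $\mathbf{r}$ be a table with $n$ tuples, $X$ a (possibly empty) set of attributes, and $A, B$ two attributes. Validating the conditional implicit-to-implicit order compatibility (I/I OC) candidate $X\colon A^* \sim B^*$ over $\mathbf{r}$ can be done in time $\mathcal{O}(n)$.
   Context: A table $\mathbf{r}$ is a finite collection of tuples. The partition groups of $\mathbf r$ by an attribute set $X$ are the maximal sets of tuples agreeing on all attributes of $X$ (a single group, the whole table, if $X=\emptyset$). A strong total order is a transitive, irreflexive relation in which any two distinct elements are comparable. For a strong total order $T$ on a set of tuples and an attribute $C$, list the $C$-values of the tuples in the order $T$ and collapse adjacent equal values. If no value then occurs twice, $T$ is said to project to a strong total order on $C$'s values. A witness for $A^*\sim B^*$ over a set $E$ of tuples is a strong total order on $E$ that projects to a strong total order both on the $A$-values and on the $B$-values of $E$. (No order on $A$ or $B$ is given.) The conditional I/I OC $X\colon A^*\sim B^*$ is valid over $\mathbf r$ if every partition group of $\mathbf r$ by $X$ has a witness. Hashing and comparing values cost constant time (hash tables are used). *)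

theory Defs
  imports "HOL-Library.Landau_Symbols"
begin

section \<open>Tables and order compatibility\<close>

text \<open>
  A table with \<open>m\<close> attributes is a list of rows of length \<open>m\<close>; attributes are column numbers.
  The tuples of a table are identified by their row numbers, so a table may contain equal
  tuples (a table that is a set of tuples is the case of a distinct list).
\<close>

definition is_table :: "nat \<Rightarrow> 'v list list \<Rightarrow> bool" where
  "is_table m r \<longleftrightarrow> (\<forall>t \<in> set r. length t = m)"

definition tuples :: "'v list list \<Rightarrow> nat set" where
  "tuples r = {..<length r}"

definition val :: "'v list list \<Rightarrow> nat \<Rightarrow> nat \<Rightarrow> 'v" where
  "val r C i = r ! i ! C"

definition agree_on :: "'v list list \<Rightarrow> nat set \<Rightarrow> nat set \<Rightarrow> bool" where
  "agree_on r X E \<longleftrightarrow> (\<forall>i \<in> E. \<forall>j \<in> E. \<forall>C \<in> X. val r C i = val r C j)"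

definition partition_groups :: "'v list list \<Rightarrow> nat set \<Rightarrow> nat set set" where
  "partition_groups r X =
     {E. E \<subseteq> tuples r \<and> agree_on r X E \<and>
         (\<forall>F. E \<subset> F \<and> F \<subseteq> tuples r \<longrightarrow> \<not> agree_on r X F)}"

definition strong_total_order_on :: "'a set \<Rightarrow> 'a rel \<Rightarrow> bool" where
  "strong_total_order_on E T \<longleftrightarrow> T \<subseteq> E \<times> E \<and> strict_linear_order_on E T"

text \<open>
  For a finite set \<open>E\<close> and a strong total order \<open>T\<close> on it, the list \<open>es\<close> below exists and is
  unique.
\<close>

definition projects_to :: "nat set \<Rightarrow> nat rel \<Rightarrow> (nat \<Rightarrow> 'v) \<Rightarrow> bool" where
  "projects_to E T f \<longleftrightarrow>
     (\<exists>es. set es = E \<and> distinct es \<and> sorted_wrt (\<lambda>i j. (i, j) \<in> T) es \<and>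
           distinct (remdups_adj (map f es)))"

definition is_witness :: "'v list list \<Rightarrow> nat \<Rightarrow> nat \<Rightarrow> nat set \<Rightarrow> nat rel \<Rightarrow> bool" where
  "is_witness r A B E T \<longleftrightarrow>
     strong_total_order_on E T \<and> projects_to E T (val r A) \<and> projects_to E T (val r B)"

definition valid_II_OC :: "'v list list \<Rightarrow> nat set \<Rightarrow> nat \<Rightarrow> nat \<Rightarrow> bool" where
  "valid_II_OC r X A B \<longleftrightarrow> (\<forall>E \<in> partition_groups r X. \<exists>T. is_witness r A B E T)"

section \<open>Programs and their running time\<close>

text \<open>
  A register machine with hash tables. A word is a number or an attribute value; attribute
  values are opaque and can only be copied, compared for equality and used as keys. Hash
  tables are keyed by pairs of words, and absent keys read as \<open>Num 0\<close>. Arithmetic is limited to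
  successor and predecessor, so that unit cost per instruction is adequate: numbers exceed
  those of the input and of the program text by at most the running time. Reading the
  projection of a tuple to \<open>k\<close> attributes takes \<open>k\<close> accesses, each of them charged.
\<close>

datatype 'v wrd = Num nat | Val 'v

record 'v state =
  reg :: "nat \<Rightarrow> 'v wrd"
  tab :: "nat \<Rightarrow> 'v wrd \<Rightarrow> 'v wrd \<Rightarrow> 'v wrd"

datatype com =
    Const nat nat
  | Copy nat nat
  | Inc nat
  | Dec nat
  | Get nat nat nat nat
  | Put nat nat nat nat
  | Seq com com
  | IfEq nat nat com com
  | WhileNeq nat nat com

fun map_num :: "(nat \<Rightarrow> nat) \<Rightarrow> 'v wrd \<Rightarrow> 'v wrd" where
  "map_num g (Num k) = Num (g k)"
| "map_num g (Val v) = Val v"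

definition set_reg :: "nat \<Rightarrow> 'v wrd \<Rightarrow> 'v state \<Rightarrow> 'v state" where
  "set_reg x w s = s\<lparr>reg := (reg s)(x := w)\<rparr>"

definition set_tab :: "nat \<Rightarrow> 'v wrd \<Rightarrow> 'v wrd \<Rightarrow> 'v wrd \<Rightarrow> 'v state \<Rightarrow> 'v state" where
  "set_tab h k l w s = s\<lparr>tab := (tab s)(h := (tab s h)(k := (tab s h k)(l := w)))\<rparr>"

text \<open>
  \<open>exec c s t s'\<close>: started in \<open>s\<close>, the program \<open>c\<close> halts in \<open>s'\<close> after \<open>t\<close> steps. Every basic
  instruction and every evaluation of a test is one step.
\<close>

inductive exec :: "com \<Rightarrow> 'v state \<Rightarrow> nat \<Rightarrow> 'v state \<Rightarrow> bool" where
  Const: "exec (Const x k) s 1 (set_reg x (Num k) s)"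
| Copy: "exec (Copy x y) s 1 (set_reg x (reg s y) s)"
| Inc: "exec (Inc x) s 1 (set_reg x (map_num Suc (reg s x)) s)"
| Dec: "exec (Dec x) s 1 (set_reg x (map_num (\<lambda>k. k - 1) (reg s x)) s)"
| Get: "exec (Get x h y z) s 1 (set_reg x (tab s h (reg s y) (reg s z)) s)"
| Put: "exec (Put h y z x) s 1 (set_tab h (reg s y) (reg s z) (reg s x) s)"
| Seq: "exec c s t s' \<Longrightarrow> exec d s' t' s'' \<Longrightarrow> exec (Seq c d) s (t + t') s''"
| IfTrue: "reg s x = reg s y \<Longrightarrow> exec c s t s' \<Longrightarrow> exec (IfEq x y c d) s (1 + t) s'"
| IfFalse: "reg s x \<noteq> reg s y \<Longrightarrow> exec d s t s' \<Longrightarrow> exec (IfEq x y c d) s (1 + t) s'"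
| WhileFalse: "reg s x = reg s y \<Longrightarrow> exec (WhileNeq x y c) s 1 s"
| WhileTrue: "reg s x \<noteq> reg s y \<Longrightarrow> exec c s t s' \<Longrightarrow> exec (WhileNeq x y c) s' t' s'' \<Longrightarrow>
    exec (WhileNeq x y c) s (1 + t + t') s''"

inductive_cases exec_elims:
  "exec (Const x k) s t s'"
  "exec (Copy x y) s t s'"
  "exec (Inc x) s t s'"
  "exec (Dec x) s t s'"
  "exec (Get x h y z) s t s'"
  "exec (Put h y z x) s t s'"
  "exec (Seq c d) s t s'"
  "exec (IfEq x y c d) s t s'"
  "exec (WhileNeq x y c) s t s'"

lemma exec_deterministic:
  "exec c s t s' \<Longrightarrow> exec c s u s'' \<Longrightarrow> t = u \<and> s' = s''"
proof (induction arbitrary: u s'' rule: exec.induct)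
  case (Seq c s t s' d t' s1)
  show ?case by (rule exec_elims(7)[OF Seq.prems]) (metis Seq.IH)
next
  case (IfTrue s x y c t s' d)
  show ?case by (rule exec_elims(8)[OF IfTrue.prems]) (auto dest!: IfTrue.IH simp: IfTrue.hyps(1))
next
  case (IfFalse s x y d t s' c)
  show ?case by (rule exec_elims(8)[OF IfFalse.prems]) (auto dest!: IfFalse.IH simp: IfFalse.hyps(1))
next
  case (WhileFalse s x y c)
  show ?case by (rule exec_elims(9)[OF WhileFalse.prems]) (use WhileFalse.hyps in simp_all)
next
  case (WhileTrue s x y c t s' t' s1)
  show ?case by (rule exec_elims(9)[OF WhileTrue.prems]) (auto dest!: WhileTrue.IH simp: WhileTrue.hyps(1))
qed (erule exec_elims, simp)+

text \<open>
  Input: registers 0 to 3 hold the number of tuples, the number of attributes in \<open>X\<close>, \<open>A\<close> and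
  \<open>B\<close>; table 0 holds the cells of \<open>r\<close> under (row, column); table 1 holds the \<open>j\<close>-th attribute
  of \<open>X\<close> under \<open>(j, 0)\<close>. Everything else is \<open>Num 0\<close>. The output is left in register 0.
\<close>

fun cell :: "'v list list \<Rightarrow> 'v wrd \<Rightarrow> 'v wrd \<Rightarrow> 'v wrd" where
  "cell r (Num i) (Num a) =
     (if i < length r \<and> a < length (r ! i) then Val (val r a i) else Num 0)"
| "cell r _ _ = Num 0"

fun attr_entry :: "nat list \<Rightarrow> 'v wrd \<Rightarrow> 'v wrd \<Rightarrow> 'v wrd" where
  "attr_entry X (Num j) (Num l) = Num (if j < length X \<and> l = 0 then X ! j else 0)"
| "attr_entry X _ _ = Num 0"

definition init_state :: "'v list list \<Rightarrow> nat list \<Rightarrow> nat \<Rightarrow> nat \<Rightarrow> 'v state" where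
  "init_state r X A B =
     \<lparr>reg = (\<lambda>_. Num 0)(0 := Num (length r), 1 := Num (length X), 2 := Num A, 3 := Num B),
      tab = (\<lambda>_ _ _. Num 0)(0 := cell r, 1 := attr_entry X)\<rparr>"

definition result :: "'v state \<Rightarrow> 'v wrd" where
  "result s = reg s 0"

end

theory Submission
  imports Defs
begin

text \<open>
  Regard each row as an edge between its \<open>A\<close>-value and its \<open>B\<close>-value, both tagged with the
  partition group of the row. An order as required exists iff this bipartite graph is a forest of
  caterpillars: the core edges, i.e. those whose two ends both have at least two neighbours, must
  form disjoint paths. Indeed, a vertex with three core edges or a cycle contradicts the
  contiguity of the edges at a vertex, and disjoint paths can be read off one after the other,
  with the leaves inserted at their path vertices.

  The program numbers the vertices through a trie over \<open>X\<close>, flags the vertices with two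
  neighbours, and then adds the core edges one by one. Since the edges added so far form paths, it
  suffices to know for each end of a path the opposite end, so that every row takes constant time.
\<close>

section \<open>Orders as numberings\<close>

text \<open>Rows that repeat a pair of vertices give the same edge, so the combinatorics speaks of
  edges as two-element sets, and table 8 keeps a repeated core edge from being taken for a conflict.
  Looking at core edges only loses no cycle, because every vertex of a cycle has two neighbours.
  Adding edges one at a time would normally call for a union-find structure, whose operations do not
  take constant time. It is avoided because a new core edge either joins ends of different paths or
  shows at once that no order exists; so the path of an inner vertex is never looked up. The value 0
  at inner vertices is enough to detect a third core edge, and the numbers handed out start at 1
  because 0 also stands for absent entries. A negative verdict is justified at the moment it arises,
  a positive one only at the end, by building an order from the paths. The bound is linear for each
  fixed number of attributes: per row, the trie takes one step down for each attribute of
  \<open>X\<close>.\<close>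

lemma lex_le: "a * M + b \<le> c * M + d \<Longrightarrow> d < M \<Longrightarrow> a \<le> (c::nat)"
proof (rule ccontr)
  assume h: "a * M + b \<le> c * M + d" "d < M" "\<not> a \<le> c"
  then have "Suc c * M \<le> a * M" by (intro mult_le_mono1) auto
  then show False using h(1,2) by simp
qed

text \<open>Numberings replace relations because they can be combined by arithmetic. Injectivity of
  \<open>p\<close> is kept as a separate requirement.\<close>

definition convex_along :: "('a \<Rightarrow> nat) \<Rightarrow> 'a set \<Rightarrow> ('a \<Rightarrow> 'b) \<Rightarrow> bool" where
  "convex_along p E f \<longleftrightarrow>
     (\<forall>x\<in>E. \<forall>y\<in>E. \<forall>z\<in>E. p x < p y \<longrightarrow> p y < p z \<longrightarrow> f x = f z \<longrightarrow> f y = f x)"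

definition contiguous :: "'a list \<Rightarrow> bool" where
  "contiguous xs \<longleftrightarrow>
     (\<forall>i j k. i < j \<longrightarrow> j < k \<longrightarrow> k < length xs \<longrightarrow> xs ! i = xs ! k \<longrightarrow> xs ! j = xs ! i)"

lemma contiguous_Cons:
  "contiguous (x # ys) \<longleftrightarrow>
     contiguous ys \<and> (\<forall>j k. j < k \<longrightarrow> k < length ys \<longrightarrow> ys ! k = x \<longrightarrow> ys ! j = x)"
  (is "?L \<longleftrightarrow> ?R1 \<and> ?R2")
proof (intro iffI conjI)
  assume L: ?L
  note L' = L[unfolded contiguous_def, rule_format]
  show ?R1
    unfolding contiguous_def
  proof (intro allI impI)
    fix i j k assume "i < j" "j < k" "k < length ys" "ys ! i = ys ! k"
    then show "ys ! j = ys ! i" using L'[of "Suc i" "Suc j" "Suc k"] by simp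
  qed
  show ?R2
  proof (intro allI impI)
    fix j k assume "j < k" "k < length ys" "ys ! k = x"
    then show "ys ! j = x" using L'[of 0 "Suc j" "Suc k"] by simp
  qed
next
  assume R: "?R1 \<and> ?R2"
  note R1 = R[THEN conjunct1, unfolded contiguous_def, rule_format]
    and R2 = R[THEN conjunct2, rule_format]
  show ?L
    unfolding contiguous_def
  proof (intro allI impI)
    fix i j k
    assume h: "i < j" "j < k" "k < length (x # ys)" "(x # ys) ! i = (x # ys) ! k"
    obtain j' k' where jk: "j = Suc j'" "k = Suc k'" using h(1,2) by (cases j; cases k) auto
    show "(x # ys) ! j = (x # ys) ! i"
    proof (cases i)
      case 0
      then show ?thesis using R2[of j' k'] h jk by simp
    next
      case (Suc i')
      then show ?thesis using R1[of i' j' k'] h jk by simp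
    qed
  qed
qed

text \<open>The first two entries decide: if they are equal, the head adds no condition, since the
  tail already begins with that value; otherwise the head must not occur again.\<close>

lemma distinct_remdups_adj_iff: "distinct (remdups_adj xs) \<longleftrightarrow> contiguous xs"
proof (induction xs rule: remdups_adj.induct)
  case (3 x y xs)
  show ?case
  proof (cases "x = y")
    case True
    have "ys ! j = x" if "contiguous ys" "ys = x # xs" "j < k" "k < length ys" "ys ! k = x"
      for j k ys
      using that(1)[unfolded contiguous_def, rule_format, of 0 j k] that(2-)
      by (cases "j = 0") auto
    then have "contiguous (x # x # xs) \<longleftrightarrow> contiguous (x # xs)"
      unfolding contiguous_Cons[of x "x # xs"] by blast
    then show ?thesis using 3(1) True by simp
  next
    case False
    have "(\<forall>j k. j < k \<longrightarrow> k < length ys \<longrightarrow> ys ! k = x \<longrightarrow> ys ! j = x) \<longleftrightarrow> x \<notin> set ys"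
      (is "?R \<longleftrightarrow> _") if "ys = y # xs" for ys
    proof
      assume R: ?R
      show "x \<notin> set ys"
      proof
        assume "x \<in> set ys"
        then obtain k where k: "k < length ys" "ys ! k = x" by (auto simp: in_set_conv_nth)
        then have "0 < k" using False that by (cases k) auto
        then show False using R[rule_format, of 0 k] k False that by simp
      qed
    qed (auto simp: in_set_conv_nth)
    then have "contiguous (x # y # xs) \<longleftrightarrow> contiguous (y # xs) \<and> x \<notin> set (y # xs)"
      unfolding contiguous_Cons[of x "y # xs"] by blast
    then show ?thesis using 3(2) False by auto
  qed
qed (auto simp: contiguous_def)

lemma projects_to_convex:
  assumes T: "strong_total_order_on E T" and proj: "projects_to E T f"
    and xyz: "(x, y) \<in> T" "(y, z) \<in> T" "f x = f z"
  shows "f y = f x"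
proof -
  obtain es where es: "set es = E" "sorted_wrt (\<lambda>i j. (i, j) \<in> T) es"
    "distinct (remdups_adj (map f es))"
    using proj unfolding projects_to_def by blast
  have "x \<in> E" "y \<in> E" "z \<in> E"
    using T xyz unfolding strong_total_order_on_def by auto
  then obtain i j k where ijk: "i < length es" "es ! i = x" "j < length es" "es ! j = y"
      "k < length es" "es ! k = z"
    unfolding es(1)[symmetric] in_set_conv_nth by blast
  have lt: "a < b" if "(es ! a, es ! b) \<in> T" "a < length es" "b < length es" for a b
  proof (rule ccontr)
    assume "\<not> a < b"
    then have "a = b \<or> b < a" by auto
    moreover have "irrefl T" "trans T"
      using T unfolding strong_total_order_on_def strict_linear_order_on_def by auto
    ultimately show False
      using that sorted_wrt_nth_less[OF es(2)] by (metis irrefl_def transD)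
  qed
  have "i < j" "j < k" using lt ijk xyz by auto
  then show ?thesis
    using es(3)[unfolded distinct_remdups_adj_iff contiguous_def, rule_format, of i j k] ijk xyz(3) by simp
qed

text \<open>The numbering is the rank, the number of predecessors. The bound by
  \<open>card E\<close> is recorded because ranks of different groups later serve as lower digits of
  one number.\<close>

lemma is_witness_imp_convex:
  assumes "finite E" and "is_witness r A B E T"
  obtains p where "inj_on p E" "p ` E \<subseteq> {..<card E}"
    "convex_along p E (val r A)" "convex_along p E (val r B)"
proof -
  define p where "p x = card {y \<in> E. (y, x) \<in> T}" for x
  have T: "strong_total_order_on E T" and PA: "projects_to E T (val r A)"
    and PB: "projects_to E T (val r B)"
    using assms(2) unfolding is_witness_def by auto
  have irr: "irrefl T" and tr: "trans T" and tot: "total_on E T"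
    using T unfolding strong_total_order_on_def strict_linear_order_on_def by auto
  have mono: "p x < p y" if "(x, y) \<in> T" for x y
    unfolding p_def
  proof (rule psubset_card_mono)
    have "x \<in> E" using T that unfolding strong_total_order_on_def by auto
    then have "x \<in> {z \<in> E. (z, y) \<in> T}" "x \<notin> {z \<in> E. (z, x) \<in> T}"
      using that irr by (auto simp: irrefl_def)
    moreover have "{z \<in> E. (z, x) \<in> T} \<subseteq> {z \<in> E. (z, y) \<in> T}"
      using tr that by (auto dest: transD)
    ultimately show "{z \<in> E. (z, x) \<in> T} \<subset> {z \<in> E. (z, y) \<in> T}" by blast
  qed (use assms(1) in simp)
  have bwd: "(x, y) \<in> T" if "x \<in> E" "y \<in> E" "p x < p y" for x y
    using tot that mono[of y x] unfolding total_on_def by (metis less_asym less_irrefl)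
  show thesis
  proof
    show "inj_on p E"
      using tot mono unfolding total_on_def inj_on_def by (metis less_irrefl)
    show "p ` E \<subseteq> {..<card E}"
    proof
      fix k assume "k \<in> p ` E"
      then obtain x where x: "x \<in> E" "k = p x" by auto
      have "{y \<in> E. (y, x) \<in> T} \<subset> E" using x irr by (auto simp: irrefl_def)
      then show "k \<in> {..<card E}"
        using psubset_card_mono[OF assms(1)] x(2) by (simp add: p_def)
    qed
    show "convex_along p E (val r A)"
      unfolding convex_along_def
      by (intro ballI impI, rule projects_to_convex[OF T PA bwd bwd]) assumption+
    show "convex_along p E (val r B)"
      unfolding convex_along_def
      by (intro ballI impI, rule projects_to_convex[OF T PB bwd bwd]) assumption+
  qed
qed

lemma projects_to_of_convex:
  assumes "finite E" "inj_on p E" "convex_along p E f"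
  shows "projects_to E {(x, y) \<in> E \<times> E. p x < p y} f"
proof -
  define es where "es = sort_key p (sorted_list_of_set E)"
  have es: "set es = E" "distinct es" "sorted (map p es)"
    using assms(1) by (auto simp: es_def)
  have "distinct (map p es)" using es assms(2) by (simp add: distinct_map)
  then have "sorted_wrt (<) (map p es)" using es(3) by (simp add: strict_sorted_iff)
  then have lt: "p (es ! i) < p (es ! j)" if "i < j" "j < length es" for i j
    using sorted_wrt_nth_less[of "(<)" "map p es" i j] that by auto
  have "sorted_wrt (\<lambda>i j. (i, j) \<in> {(x, y) \<in> E \<times> E. p x < p y}) es"
    unfolding sorted_wrt_iff_nth_less using lt es(1) by (auto simp: es(1)[symmetric])
  moreover have "distinct (remdups_adj (map f es))"
    unfolding distinct_remdups_adj_iff contiguous_def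
  proof (intro allI impI)
    fix i j k assume h: "i < j" "j < k" "k < length (map f es)" "map f es ! i = map f es ! k"
    have "es ! i \<in> E" "es ! j \<in> E" "es ! k \<in> E" using h by (auto simp: es(1)[symmetric])
    then show "map f es ! j = map f es ! i"
      using assms(3) lt[of i j] lt[of j k] h unfolding convex_along_def by auto
  qed
  ultimately show ?thesis unfolding projects_to_def using es by blast
qed

lemma is_witness_of_convex:
  assumes "finite E" "inj_on p E" "convex_along p E (val r A)" "convex_along p E (val r B)"
  shows "is_witness r A B E {(x, y) \<in> E \<times> E. p x < p y}"
  using assms projects_to_of_convex[OF assms(1,2)]
  unfolding is_witness_def strong_total_order_on_def strict_linear_order_on_def
  by (auto simp: trans_def irrefl_def total_on_def inj_on_def) (metis neqE)

definition orderable :: "nat \<Rightarrow> (nat \<Rightarrow> 'a) \<Rightarrow> (nat \<Rightarrow> 'b) \<Rightarrow> bool" where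
  "orderable n f g \<longleftrightarrow>
     (\<exists>p. inj_on p {..<n} \<and> convex_along p {..<n} f \<and> convex_along p {..<n} g)"

lemma convex_along_cong_on:
  assumes "convex_along p D f" "E \<subseteq> D" "\<And>x y. x \<in> E \<Longrightarrow> y \<in> E \<Longrightarrow> f x = f y \<longleftrightarrow> g x = g y"
  shows "convex_along p E g"
  using assms unfolding convex_along_def by (metis subsetD)

text \<open>
  Tagging the values with the partition group of their tuple reduces all groups to a single
  ordering problem on the whole table.
\<close>

lemma valid_iff_orderable:
  fixes g u v :: "nat \<Rightarrow> nat"
  assumes g: "\<And>i j. i < length r \<Longrightarrow> j < length r \<Longrightarrow>
      g i = g j \<longleftrightarrow> (\<forall>C\<in>X. val r C i = val r C j)"
    and u: "\<And>i j. i < length r \<Longrightarrow> j < length r \<Longrightarrow>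
      u i = u j \<longleftrightarrow> g i = g j \<and> val r A i = val r A j"
    and v: "\<And>i j. i < length r \<Longrightarrow> j < length r \<Longrightarrow>
      v i = v j \<longleftrightarrow> g i = g j \<and> val r B i = val r B j"
  shows "valid_II_OC r X A B \<longleftrightarrow> orderable (length r) u v"
proof
  assume valid: "valid_II_OC r X A B"
  let ?n = "length r"
  define G where "G i = {j. j < ?n \<and> g j = g i}" for i
  have "\<exists>p. inj_on p (G i) \<and> p ` G i \<subseteq> {..<?n} \<and> convex_along p (G i) u \<and> convex_along p (G i) v"
    if i: "i < ?n" for i
  proof -
    have "G i \<in> partition_groups r X"
      unfolding partition_groups_def
    proof (intro CollectI conjI allI impI notI)
      show "G i \<subseteq> tuples r" by (auto simp: G_def tuples_def)
      show "agree_on r X (G i)"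
        unfolding agree_on_def G_def using g by (metis (mono_tags, lifting) mem_Collect_eq)
      fix F assume "G i \<subset> F \<and> F \<subseteq> tuples r" "agree_on r X F"
      then have F: "G i \<subset> F" "F \<subseteq> tuples r" "agree_on r X F" by auto
      then obtain j where j: "j \<in> F" "j \<notin> G i" by blast
      have "i \<in> F" using F(1) i by (auto simp: G_def)
      then have "\<forall>C\<in>X. val r C j = val r C i"
        using F(3) j(1) unfolding agree_on_def by blast
      moreover have "j < ?n" using F(2) j(1) by (auto simp: tuples_def)
      ultimately show False using j(2) g[of j i] i by (simp add: G_def)
    qed
    then obtain T where "is_witness r A B (G i) T"
      using valid unfolding valid_II_OC_def by blast
    moreover have fin: "finite (G i)" by (simp add: G_def)
    ultimately obtain p where p: "inj_on p (G i)" "p ` G i \<subseteq> {..<card (G i)}"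
        "convex_along p (G i) (val r A)" "convex_along p (G i) (val r B)"
      using is_witness_imp_convex by blast
    have "card (G i) \<le> ?n"
      using card_mono[of "{..<?n}" "G i"] by (auto simp: G_def)
    moreover have "convex_along p (G i) u"
      by (rule convex_along_cong_on[OF p(3)]) (use u in \<open>auto simp: G_def\<close>)
    moreover have "convex_along p (G i) v"
      by (rule convex_along_cong_on[OF p(4)]) (use v in \<open>auto simp: G_def\<close>)
    ultimately show ?thesis using p by (meson lessThan_subset_iff order_trans)
  qed
  note local = this
  \<comment> \<open>Every number \<open>c\<close> gets a numbering, also those that name no group,
    so that a choice function exists.\<close>
  define P where "P c p \<longleftrightarrow> inj_on p {j. j < ?n \<and> g j = c} \<and>
      p ` {j. j < ?n \<and> g j = c} \<subseteq> {..<?n} \<and>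
      convex_along p {j. j < ?n \<and> g j = c} u \<and> convex_along p {j. j < ?n \<and> g j = c} v"
    for c p
  have "\<exists>p. P c p" for c
  proof (cases "\<exists>i<?n. g i = c")
    case True
    then show ?thesis using local unfolding P_def G_def by blast
  next
    case False
    then have "{j. j < ?n \<and> g j = c} = {}" by auto
    then show ?thesis by (simp only: P_def convex_along_def) simp
  qed
  then obtain p where "\<And>c. P c (p c)" by metis
  then have p: "\<And>c. inj_on (p c) {j. j < ?n \<and> g j = c}"
      "\<And>c. p c ` {j. j < ?n \<and> g j = c} \<subseteq> {..<?n}"
      "\<And>c. convex_along (p c) {j. j < ?n \<and> g j = c} u"
      "\<And>c. convex_along (p c) {j. j < ?n \<and> g j = c} v"
    unfolding P_def by blast+
  \<comment> \<open>Two digits to base \<open>?n\<close>: the group leads and the rank inside the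
    group follows, which keeps the groups apart.\<close>
  define q where "q i = g i * ?n + p (g i) i" for i
  have plt: "p (g i) i < ?n" if "i < ?n" for i using p(2)[of "g i"] that by auto
  have gle: "g i \<le> g j" if "q i \<le> q j" "i < ?n" "j < ?n" for i j
    using lex_le[of "g i" ?n "p (g i) i" "g j" "p (g j) j"] that plt[OF that(3)] by (simp add: q_def)
  have cvx: "convex_along q {..<?n} f"
    if f: "\<And>i j. i < ?n \<Longrightarrow> j < ?n \<Longrightarrow> f i = f j \<Longrightarrow> g i = g j"
      and pf: "\<And>c. convex_along (p c) {j. j < ?n \<and> g j = c} f" for f :: "nat \<Rightarrow> nat"
    unfolding convex_along_def
  proof (intro ballI impI)
    fix x y z assume h: "x \<in> {..<?n}" "y \<in> {..<?n}" "z \<in> {..<?n}" "q x < q y" "q y < q z" "f x = f z"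
    \<comment> \<open>The leading digit is monotone in \<open>q\<close>, so a row between two rows
      of one group belongs to that group.\<close>
    have gg: "g x = g z" "g y = g z" using f[of x z] gle[of x y] gle[of y z] h by auto
    then have "p (g z) x < p (g z) y" "p (g z) y < p (g z) z" using h by (auto simp: q_def)
    then show "f y = f x" using pf[of "g z"] gg h unfolding convex_along_def by auto
  qed
  have "inj_on q {..<?n}"
  proof (rule inj_onI)
    fix x y assume h: "x \<in> {..<?n}" "y \<in> {..<?n}" "q x = q y"
    have "g x = g y" using gle[of x y] gle[of y x] h by auto
    then show "x = y" using h p(1)[of "g y"] by (auto simp: q_def inj_on_def)
  qed
  moreover have "convex_along q {..<?n} u" by (rule cvx) (use u p(3) in auto)
  moreover have "convex_along q {..<?n} v" by (rule cvx) (use v p(4) in auto)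
  ultimately show "orderable ?n u v" unfolding orderable_def by blast
next
  let ?n = "length r"
  assume "orderable ?n u v"
  then obtain p where p: "inj_on p {..<?n}" "convex_along p {..<?n} u" "convex_along p {..<?n} v"
    unfolding orderable_def by blast
  show "valid_II_OC r X A B"
    unfolding valid_II_OC_def
  proof
    fix E assume "E \<in> partition_groups r X"
    then have E: "E \<subseteq> {..<?n}" "agree_on r X E" by (auto simp: partition_groups_def tuples_def)
    have gE: "g i = g j" if ij: "i \<in> E" "j \<in> E" for i j
    proof -
      have "\<forall>C\<in>X. val r C i = val r C j" using E(2) ij unfolding agree_on_def by blast
      moreover have "i < ?n" "j < ?n" using E(1) ij by auto
      ultimately show ?thesis using g by blast
    qed
    have "convex_along p E (val r A)"
    proof (rule convex_along_cong_on[OF p(2) E(1)])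
      fix x y assume xy: "x \<in> E" "y \<in> E"
      then have "x < ?n" "y < ?n" using E(1) by auto
      then show "u x = u y \<longleftrightarrow> val r A x = val r A y"
        using gE[OF xy] by (simp only: u simp_thms)
    qed
    moreover have "convex_along p E (val r B)"
    proof (rule convex_along_cong_on[OF p(3) E(1)])
      fix x y assume xy: "x \<in> E" "y \<in> E"
      then have "x < ?n" "y < ?n" using E(1) by auto
      then show "v x = v y \<longleftrightarrow> val r B x = val r B y"
        using gE[OF xy] by (simp only: v simp_thms)
    qed
    moreover have "inj_on p E" using inj_on_subset[OF p(1) E(1)] .
    moreover have "finite E" using E(1) finite_subset by blast
    ultimately have "is_witness r A B E {(x, y) \<in> E \<times> E. p x < p y}"
      by (intro is_witness_of_convex)
    then show "\<exists>T. is_witness r A B E T" ..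
  qed
qed

section \<open>The graph of a table\<close>

text \<open>Disjoint numbers for the two sides allow an edge to be an unordered pair without
  forgetting which end belongs to which attribute. Several rows may share an edge.\<close>

locale row_graph =
  fixes n :: nat and u v :: "nat \<Rightarrow> nat"
  assumes bip: "x < n \<Longrightarrow> y < n \<Longrightarrow> u x \<noteq> v y"
begin

definition edge :: "nat \<Rightarrow> nat set" where
  "edge x = {u x, v x}"

text \<open>Edges are compared, not rows: repetitions of one edge do not make its ends
  branching.\<close>

definition branching :: "nat \<Rightarrow> bool" where
  "branching w \<longleftrightarrow> (\<exists>x<n. \<exists>y<n. w \<in> edge x \<and> w \<in> edge y \<and> edge x \<noteq> edge y)"

definition core :: "nat \<Rightarrow> bool" where
  "core x \<longleftrightarrow> branching (u x) \<and> branching (v x)"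

lemma edge_eq_iff: "x < n \<Longrightarrow> y < n \<Longrightarrow> edge x = edge y \<longleftrightarrow> u x = u y \<and> v x = v y"
  unfolding edge_def by (metis bip doubleton_eq_iff)

definition edge_convex :: "(nat \<Rightarrow> nat) \<Rightarrow> bool" where
  "edge_convex p \<longleftrightarrow> (\<forall>x<n. \<forall>y<n. \<forall>z<n. p x < p y \<longrightarrow> p y < p z \<longrightarrow>
     (\<forall>w. w \<in> edge x \<longrightarrow> w \<in> edge z \<longrightarrow> w \<in> edge y))"

lemma edge_convexD:
  "edge_convex p \<Longrightarrow> x < n \<Longrightarrow> y < n \<Longrightarrow> z < n \<Longrightarrow> p x < p y \<Longrightarrow> p y < p z \<Longrightarrow>
    w \<in> edge x \<Longrightarrow> w \<in> edge z \<Longrightarrow> w \<in> edge y"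
  unfolding edge_convex_def by blast

lemma convex_along_iff_edge_convex:
  "convex_along p {..<n} u \<and> convex_along p {..<n} v \<longleftrightarrow> edge_convex p"
proof
  assume p: "convex_along p {..<n} u \<and> convex_along p {..<n} v"
  show "edge_convex p"
    unfolding edge_convex_def
  proof (intro allI impI)
    fix x y z w
    assume h: "x < n" "y < n" "z < n" "p x < p y" "p y < p z" "w \<in> edge x" "w \<in> edge z"
    \<comment> \<open>The sides being disjoint, a common vertex is the same end of both
      rows.\<close>
    have "u x = w \<and> u z = w \<or> v x = w \<and> v z = w"
      using h(6,7) bip[OF h(1,3)] bip[OF h(3,1)] unfolding edge_def by auto
    then show "w \<in> edge y"
      using p[THEN conjunct1, unfolded convex_along_def, rule_format, of x y z]
        p[THEN conjunct2, unfolded convex_along_def, rule_format, of x y z] h(1-5)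
      by (auto simp: edge_def)
  qed
next
  assume p: "edge_convex p"
  show "convex_along p {..<n} u \<and> convex_along p {..<n} v"
    unfolding convex_along_def
  proof (intro conjI ballI impI)
    fix x y z
    assume "x \<in> {..<n}" "y \<in> {..<n}" "z \<in> {..<n}" and h: "p x < p y" "p y < p z"
    then have lt: "x < n" "y < n" "z < n" by auto
    show "u y = u x" if "u x = u z"
      using edge_convexD[OF p lt h, of "u x"] that bip[OF lt(1,2)] by (auto simp: edge_def)
    show "v y = v x" if "v x = v z"
      using edge_convexD[OF p lt h, of "v x"] that bip[OF lt(2,1)] by (auto simp: edge_def)
  qed
qed

lemma orderable_iff_edge_convex:
  "orderable n u v \<longleftrightarrow> (\<exists>p. inj_on p {..<n} \<and> edge_convex p)"
  unfolding orderable_def convex_along_iff_edge_convex ..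

text \<open>The first edge of \<open>S\<close> in an ordering has followers in \<open>S\<close> at both of its ends, and one of
  them separates the first edge from the other.\<close>

lemma leafless_not_orderable:
  assumes S: "S \<subseteq> {..<n}" "S \<noteq> {}"
    and foll: "\<And>x w. x \<in> S \<Longrightarrow> w \<in> edge x \<Longrightarrow> \<exists>y\<in>S. w \<in> edge y \<and> edge y \<noteq> edge x"
  shows "\<not> orderable n u v"
proof
  assume "orderable n u v"
  then obtain p where p: "inj_on p {..<n}" and p': "edge_convex p"
    unfolding orderable_iff_edge_convex by blast
  note cvx = edge_convexD[OF p']
  have inj: "p a = p b \<longleftrightarrow> a = b" if "a < n" "b < n" for a b
    using inj_on_eq_iff[OF p] that by simp
  have "finite S" using S(1) finite_subset by blast
  obtain x where x: "x \<in> S" "\<And>y. y \<in> S \<Longrightarrow> p x \<le> p y"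
    using ex_min_if_finite[of "p ` S"] \<open>finite S\<close> S(2) by (force simp: not_less)
  obtain y where y: "y \<in> S" "u x \<in> edge y" "edge y \<noteq> edge x"
    using foll[OF x(1), of "u x"] by (auto simp: edge_def)
  obtain z where z: "z \<in> S" "v x \<in> edge z" "edge z \<noteq> edge x"
    using foll[OF x(1), of "v x"] by (auto simp: edge_def)
  have lt: "x < n" "y < n" "z < n" using x(1) y(1) z(1) S(1) by auto
  have ne: "v x \<notin> edge y" "u x \<notin> edge z"
    using y z bip[OF lt(1,2)] bip[OF lt(2,1)] bip[OF lt(1,3)] bip[OF lt(3,1)]
    unfolding edge_def by auto
  have "p x \<noteq> p y" "p x \<noteq> p z" "p y \<noteq> p z"
    using lt y z ne by (auto simp: inj)
  moreover have "p x \<le> p y" "p x \<le> p z" using x(2) y(1) z(1) by auto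
  ultimately have "p x < p y \<and> p y < p z \<or> p x < p z \<and> p z < p y" by linarith
  then show False
  proof
    assume "p x < p y \<and> p y < p z"
    then show False using cvx[of x y z "v x"] lt z(2) ne(1) by (auto simp: edge_def)
  next
    assume "p x < p z \<and> p z < p y"
    then show False using cvx[of x z y "u x"] lt y(2) ne(2) by (auto simp: edge_def)
  qed
qed

text \<open>Consider the middle one of the three rows and a second edge \<open>t\<close> at its end
  other than \<open>w\<close>. Between the outer two, \<open>t\<close> would have to contain
  \<open>w\<close> and so equal the middle edge; outside them, one of the outer edges separates
  \<open>t\<close> from the middle one. As all three are core, any of them may be the middle
  one.\<close>

lemma three_core_edges_not_orderable:
  assumes "x < n" "y < n" "z < n" "core x" "core y" "core z"
    and "w \<in> edge x" "w \<in> edge y" "w \<in> edge z"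
    and "edge x \<noteq> edge y" "edge y \<noteq> edge z" "edge x \<noteq> edge z"
  shows "\<not> orderable n u v"
proof
  assume "orderable n u v"
  then obtain p where p: "inj_on p {..<n}" and p': "edge_convex p"
    unfolding orderable_iff_edge_convex by blast
  note cvx = edge_convexD[OF p']
  have inj: "p a = p b \<longleftrightarrow> a = b" if "a < n" "b < n" for a b
    using inj_on_eq_iff[OF p] that by simp
  have middle: False if lt: "x < n" "y < n" "z < n" and "core y" "p x < p y" "p y < p z"
    and w: "w \<in> edge x" "w \<in> edge y" "w \<in> edge z"
    and ne: "edge x \<noteq> edge y" "edge y \<noteq> edge z" for x y z
  proof -
    \<comment> \<open>The end of \<open>y\<close> other than \<open>w\<close>.\<close>
    define b where "b = (if w = u y then v y else u y)"
    have b: "edge y = {w, b}" "w \<noteq> b"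
      using w(2) bip[OF lt(2,2)] by (auto simp: b_def edge_def)
    have "branching b" using \<open>core y\<close> by (auto simp: b_def core_def)
    then obtain t where t: "t < n" "b \<in> edge t" "edge t \<noteq> edge y"
      unfolding branching_def by metis
    have wt: "w \<notin> edge t" using t b unfolding edge_def by auto
    have bx: "b \<notin> edge x" using w(1) ne(1) b unfolding edge_def by auto
    have bz: "b \<notin> edge z" using w(3) ne(2) b unfolding edge_def by auto
    have "p t \<noteq> p x" "p t \<noteq> p y" "p t \<noteq> p z" using t(1) lt w wt by (auto simp: inj)
    then consider "p t < p x" | "p x < p t" "p t < p y" | "p y < p t" "p t < p z" | "p z < p t"
      by linarith
    then show False
    proof cases
      case 1
      then show False using cvx[of t x y b] t lt that(5) b bx by simp
    next
      case 2
      then show False using cvx[of x t y w] t lt w wt by simp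
    next
      case 3
      then show False using cvx[of y t z w] t lt w wt by simp
    next
      case 4
      then show False using cvx[of y z t b] t lt that(6) b bz by simp
    qed
  qed
  have "p x \<noteq> p y" "p y \<noteq> p z" "p x \<noteq> p z" using assms by (auto simp: inj)
  then consider "p x < p y" "p y < p z" | "p z < p y" "p y < p x" | "p y < p x" "p x < p z"
    | "p z < p x" "p x < p y" | "p x < p z" "p z < p y" | "p y < p z" "p z < p x"
    by linarith
  then show False
  proof cases
    case 1
    show False by (rule middle[of x y z]) (use 1 assms in auto)
  next
    case 2
    show False by (rule middle[of z y x]) (use 2 assms in auto)
  next
    case 3
    show False by (rule middle[of y x z]) (use 3 assms in auto)
  next
    case 4
    show False by (rule middle[of z x y]) (use 4 assms in auto)
  next
    case 5
    show False by (rule middle[of x z y]) (use 5 assms in auto)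
  next
    case 6
    show False by (rule middle[of y z x]) (use 6 assms in auto)
  qed
qed

end

section \<open>Systems of paths\<close>

fun links :: "'a list \<Rightarrow> 'a set set" where
  "links (x # y # p) = insert {x, y} (links (y # p))"
| "links p = {}"

lemma links_append:
  "p \<noteq> [] \<Longrightarrow> q \<noteq> [] \<Longrightarrow> links (p @ q) = insert {last p, hd q} (links p \<union> links q)"
proof (induction p rule: links.induct)
  case (1 x y p)
  then show ?case by auto
next
  case ("2_2" x)
  then show ?case by (cases q) auto
qed simp

lemma links_rev: "links (rev p) = links p"
proof (induction p)
  case (Cons x p)
  show ?case
  proof (cases p)
    case (Cons y q)
    then have "links (rev (x # p)) = insert {y, x} (links (rev p))"
      using links_append[of "rev p" "[x]"] by simp
    then show ?thesis using Cons \<open>links (rev p) = links p\<close> by (simp add: insert_commute)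
  qed simp
qed simp

lemma links_subset: "e \<in> links p \<Longrightarrow> e \<subseteq> set p"
  by (induction p rule: links.induct) auto

lemma links_nth: "e \<in> links p \<Longrightarrow> \<exists>k. Suc k < length p \<and> e = {p ! k, p ! Suc k}"
proof (induction p rule: links.induct)
  case (1 x y p)
  show ?case
  proof (cases "e = {x, y}")
    case True
    then show ?thesis by (intro exI[of _ 0]) simp
  next
    case False
    then obtain k where "Suc k < length (y # p)" "e = {(y # p) ! k, (y # p) ! Suc k}"
      using 1 by auto
    then show ?thesis by (intro exI[of _ "Suc k"]) simp
  qed
qed auto

text \<open>Concatenation adds links at the seams and destroys none. The additional links do no harm
  to the order built later, which only needs every core edge to be a link.\<close>

lemma links_concat: "p \<in> set ps \<Longrightarrow> [] \<notin> set ps \<Longrightarrow> links p \<subseteq> links (concat ps)"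
proof (induction ps)
  case (Cons q ps)
  show ?case
  proof (cases ps)
    case Nil
    then show ?thesis using Cons.prems by simp
  next
    case (Cons q' ps')
    then have "concat ps \<noteq> []" "q \<noteq> []" using Cons.prems by auto
    then show ?thesis using Cons.IH Cons.prems by (auto simp: links_append)
  qed
qed simp

lemma interior_neighbours:
  assumes "distinct p" "w \<in> set p" "w \<noteq> hd p" "w \<noteq> last p"
  obtains a b where "a \<noteq> b" "{w, a} \<in> links p" "{w, b} \<in> links p"
proof -
  obtain xs ys where p: "p = xs @ w # ys" using split_list assms(2) by metis
  have ne: "xs \<noteq> []" "ys \<noteq> []" using assms(3,4) p by auto
  have "last xs \<noteq> hd ys"
    using assms(1) last_in_set[OF ne(1)] hd_in_set[OF ne(2)] unfolding p by auto
  moreover have "{w, last xs} \<in> links p" "{w, hd ys} \<in> links p"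
    using ne links_append[of xs "w # ys"] links_append[of "[w]" ys]
    unfolding p by (auto simp: insert_commute)
  ultimately show thesis using that by blast
qed

text \<open>If the second entry were the last, the two ends would be linked.\<close>

lemma hd_neighbour:
  assumes "p \<noteq> []" "hd p \<noteq> last p" "{hd p, last p} \<notin> links p"
  obtains b where "b \<noteq> last p" "{hd p, b} \<in> links p"
proof -
  obtain b r where "p = hd p # b # r" using assms(1,2) by (cases p rule: links.cases) auto
  then have "{hd p, b} \<in> links p" by (metis insertI1 links.simps(1))
  then show thesis using that assms(3) by metis
qed

text \<open>The closing link turns the path into a cycle. Assuming it is not a link already excludes
  the path with two vertices, where closing adds nothing.\<close>

lemma cycle_neighbours:
  assumes p: "p \<noteq> []" "distinct p" "hd p \<noteq> last p" "{hd p, last p} \<notin> links p" and w: "w \<in> set p"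
  obtains a b where "a \<noteq> b" "{w, a} \<in> insert {hd p, last p} (links p)"
    "{w, b} \<in> insert {hd p, last p} (links p)"
proof -
  consider "w = hd p" | "w = last p" | "w \<noteq> hd p" "w \<noteq> last p" by blast
  then show thesis
  proof cases
    case 1
    obtain b where "b \<noteq> last p" "{hd p, b} \<in> links p" using hd_neighbour p(1,3,4) by metis
    then show thesis using that[of b "last p"] 1 by simp
  next
    case 2
    have "rev p \<noteq> []" "hd (rev p) \<noteq> last (rev p)" "{hd (rev p), last (rev p)} \<notin> links (rev p)"
      using p by (auto simp: links_rev hd_rev last_rev insert_commute)
    then obtain b where "b \<noteq> last (rev p)" "{hd (rev p), b} \<in> links (rev p)"
      using hd_neighbour by metis
    then show thesis
      using that[of b "hd p"] 2 by (simp add: links_rev hd_rev last_rev insert_commute)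
  next
    case 3
    then show thesis using interior_neighbours[OF p(2) w] that by (metis insertCI)
  qed
qed

text \<open>A partition of \<open>V\<close> into paths with edge set \<open>F\<close>; \<open>oth\<close> maps each end of a path to the
  other end, and inner vertices to \<open>0\<close>.\<close>

definition path_system ::
    "nat set \<Rightarrow> nat set set \<Rightarrow> (nat \<Rightarrow> nat) \<Rightarrow> nat list set \<Rightarrow> bool" where
  "path_system V F oth Ps \<longleftrightarrow>
     finite Ps \<and> \<Union> (set ` Ps) = V \<and> \<Union> (links ` Ps) = F \<and>
     (\<forall>p\<in>Ps. \<forall>q\<in>Ps. p \<noteq> q \<longrightarrow> set p \<inter> set q = {}) \<and>
     (\<forall>p\<in>Ps. p \<noteq> [] \<and> distinct p \<and> oth (hd p) = last p \<and> oth (last p) = hd p \<and>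
        (\<forall>x\<in>set p. x \<noteq> hd p \<longrightarrow> x \<noteq> last p \<longrightarrow> oth x = 0))"

lemma path_systemD:
  assumes "path_system V F oth Ps"
  shows "finite Ps" "\<Union> (set ` Ps) = V" "\<Union> (links ` Ps) = F"
    "p \<in> Ps \<Longrightarrow> q \<in> Ps \<Longrightarrow> p \<noteq> q \<Longrightarrow> set p \<inter> set q = {}"
    "p \<in> Ps \<Longrightarrow> p \<noteq> []" "p \<in> Ps \<Longrightarrow> distinct p"
    "p \<in> Ps \<Longrightarrow> oth (hd p) = last p" "p \<in> Ps \<Longrightarrow> oth (last p) = hd p"
    "p \<in> Ps \<Longrightarrow> x \<in> set p \<Longrightarrow> x \<noteq> hd p \<Longrightarrow> x \<noteq> last p \<Longrightarrow> oth x = 0"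
  using assms unfolding path_system_def by blast+

lemma path_system_singletons:
  assumes "finite V" "\<And>x. x \<in> V \<Longrightarrow> oth x = x"
  shows "path_system V {} oth ((\<lambda>x. [x]) ` V)"
  using assms unfolding path_system_def by auto

text \<open>Lets two paths be oriented so that the vertices to be joined are the last and the
  first.\<close>

lemma path_system_rev:
  assumes sys: "path_system V F oth Ps" and p: "p \<in> Ps"
  shows "path_system V F oth (insert (rev p) (Ps - {p}))"
proof -
  have sets: "\<Union> (set ` insert (rev p) (Ps - {p})) = \<Union> (set ` Ps)" using p by auto
  have lnks: "\<Union> (links ` insert (rev p) (Ps - {p})) = \<Union> (links ` Ps)"
    using p by (auto simp: links_rev)
  have disj: "set q \<inter> set q' = {}"
    if "q \<in> insert (rev p) (Ps - {p})" "q' \<in> insert (rev p) (Ps - {p})" "q \<noteq> q'" for q q'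
  proof -
    have new: "set t \<inter> set (rev p) = {}" if "t \<in> Ps - {p}" for t
      using path_systemD(4)[OF sys, of t p] that p by auto
    show ?thesis
      using that new[of q] new[of q'] path_systemD(4)[OF sys, of q q'] by auto
  qed
  have paths: "s \<noteq> [] \<and> distinct s \<and> oth (hd s) = last s \<and> oth (last s) = hd s \<and>
      (\<forall>x\<in>set s. x \<noteq> hd s \<longrightarrow> x \<noteq> last s \<longrightarrow> oth x = 0)"
    if s: "s \<in> insert (rev p) (Ps - {p})" for s
  proof (cases "s = rev p")
    case True
    then show ?thesis
      using path_systemD(5-8)[OF sys p] path_systemD(9)[OF sys p] by (simp add: hd_rev last_rev)
  next
    case False
    then have "s \<in> Ps" using s by simp
    then show ?thesis using path_systemD(5-9)[OF sys] by blast
  qed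
  have "finite (insert (rev p) (Ps - {p}))" using path_systemD(1)[OF sys] by simp
  moreover have "\<forall>q\<in>insert (rev p) (Ps - {p}). \<forall>q'\<in>insert (rev p) (Ps - {p}).
      q \<noteq> q' \<longrightarrow> set q \<inter> set q' = {}"
    by (intro ballI impI disj)
  ultimately show ?thesis
    unfolding path_system_def path_systemD(2,3)[OF sys, symmetric]
    using sets lnks ballI[OF paths] by (intro conjI)
qed

text \<open>Nonzero values make \<open>a\<close> and \<open>b\<close> ends, and
  \<open>oth a \<noteq> b\<close> makes them ends of different paths, which can then be
  concatenated. The zeros are written first: the vertex of a one-vertex path is its own opposite end
  and has to remain an end.\<close>

lemma path_system_link:
  assumes sys: "path_system V F oth Ps"
    and ab: "a \<in> V" "b \<in> V" "a \<noteq> b" "oth a \<noteq> 0" "oth b \<noteq> 0" "oth a \<noteq> b"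
  shows "\<exists>Ps'. path_system V (insert {a, b} F)
      (oth(a := 0, b := 0, oth a := oth b, oth b := oth a)) Ps'"
proof -
  have "\<exists>p Ps'. path_system V F oth Ps' \<and> p \<in> Ps' \<and> last p = a"
  proof -
    obtain p where p: "p \<in> Ps" "a \<in> set p" using ab(1) path_systemD(2)[OF sys] by blast
    then consider "a = last p" | "a = hd p" using path_systemD(9)[OF sys p] ab(4) by blast
    then show ?thesis
    proof cases
      case 2
      then show ?thesis using path_system_rev[OF sys p(1)] by (metis insertI1 last_rev)
    qed (use sys p in blast)
  qed
  then obtain p Ps1 where sys1: "path_system V F oth Ps1" and p: "p \<in> Ps1" "last p = a" by blast
  have "\<exists>q Ps'. path_system V F oth Ps' \<and> p \<in> Ps' \<and> q \<in> Ps' \<and> p \<noteq> q \<and> hd q = b"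
  proof -
    obtain q where q: "q \<in> Ps1" "b \<in> set q" using ab(2) path_systemD(2)[OF sys1] by blast
    then have bq: "b = last q \<or> b = hd q" using path_systemD(9)[OF sys1 q] ab(5) by blast
    \<comment> \<open>On a single path, \<open>b\<close> would be \<open>a\<close> itself or the
      opposite end \<open>oth a\<close>.\<close>
    have pq: "p \<noteq> q" using bq p ab(3,6) path_systemD(8)[OF sys1 p(1)] by auto
    show ?thesis
    proof (cases "b = hd q")
      case True
      then show ?thesis using sys1 p q pq by blast
    next
      case False
      have "p \<noteq> rev q"
      proof
        assume "p = rev q"
        then have "set p \<inter> set q = set q" by simp
        then show False using path_systemD(4)[OF sys1 p(1) q(1) pq] q(2) by auto
      qed
      moreover have "hd (rev q) = b" using False bq by (simp add: hd_rev)
      ultimately show ?thesis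
        using path_system_rev[OF sys1 q(1)] p(1) pq by blast
    qed
  qed
  then obtain q Ps2 where sys2: "path_system V F oth Ps2"
    and pq: "p \<in> Ps2" "q \<in> Ps2" "p \<noteq> q" "hd q = b" by blast
  note D = path_systemD[OF sys2]
  let ?oth = "oth(a := 0, b := 0, oth a := oth b, oth b := oth a)"
  let ?Ps = "insert (p @ q) (Ps2 - {p, q})"
  have ne: "p \<noteq> []" "q \<noteq> []" and dj: "set p \<inter> set q = {}" using D(4,5) pq by auto
  have oa: "oth a = hd p" and ob: "oth b = last q"
    using D(8)[OF pq(1)] D(7)[OF pq(2)] p(2) pq(4) by auto
  have mem: "a \<in> set p" "b \<in> set q" "hd p \<in> set p" "last q \<in> set q"
    using ne p(2) pq(4) last_in_set hd_in_set by metis+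
  \<comment> \<open>The entries that change all belong to ends of \<open>p\<close> and
    \<open>q\<close>.\<close>
  have other: "?oth x = oth x" if "s \<in> Ps2 - {p, q}" "x \<in> set s" for s x
  proof -
    have "x \<notin> set p" "x \<notin> set q" using D(4)[of s p] D(4)[of s q] that pq(1,2) by auto
    then show ?thesis using mem oa ob by auto
  qed
  have sets: "\<Union> (set ` ?Ps) = V" using D(2) pq(1,2) by auto
  have lnks: "\<Union> (links ` ?Ps) = insert {a, b} F"
    using D(3) pq(1,2,4) p(2) by (auto simp: links_append[OF ne])
  have disj: "set s \<inter> set s' = {}" if s: "s \<in> ?Ps" "s' \<in> ?Ps" "s \<noteq> s'" for s s'
  proof -
    have new: "set t \<inter> set (p @ q) = {}" if "t \<in> Ps2 - {p, q}" for t
      using D(4)[of t p] D(4)[of t q] that pq(1,2) by auto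
    show ?thesis using s new[of s] new[of s'] D(4)[of s s'] by auto
  qed
  have paths: "s \<noteq> [] \<and> distinct s \<and> ?oth (hd s) = last s \<and> ?oth (last s) = hd s \<and>
        (\<forall>x\<in>set s. x \<noteq> hd s \<longrightarrow> x \<noteq> last s \<longrightarrow> ?oth x = 0)" if s: "s \<in> ?Ps" for s
  proof (cases "s = p @ q")
    case True
    have "hd p \<noteq> last q" using mem dj by auto
    moreover have "?oth x = 0" if "x \<in> set (p @ q)" "x \<noteq> hd p" "x \<noteq> last q" for x
      using that D(9)[OF pq(1), of x] D(9)[OF pq(2), of x] p(2) pq(4) oa ob by auto
    ultimately show ?thesis
      using True ne dj D(6)[OF pq(1)] D(6)[OF pq(2)] oa ob by auto
  next
    case False
    then have s': "s \<in> Ps2 - {p, q}" "s \<in> Ps2" using s by auto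
    have hl: "hd s \<in> set s" "last s \<in> set s" using D(5)[OF s'(2)] by auto
    have "?oth (hd s) = last s" "?oth (last s) = hd s"
      using other[OF s'(1)] hl D(7,8)[OF s'(2)] by metis+
    moreover have "?oth x = 0" if "x \<in> set s" "x \<noteq> hd s" "x \<noteq> last s" for x
      using other[OF s'(1) that(1)] D(9)[OF s'(2) that] by metis
    ultimately show ?thesis using D(5,6)[OF s'(2)] by blast
  qed
  have "finite ?Ps" using D(1) by simp
  moreover have "\<forall>s\<in>?Ps. \<forall>s'\<in>?Ps. s \<noteq> s' \<longrightarrow> set s \<inter> set s' = {}"
    by (intro ballI impI disj)
  ultimately have "path_system V (insert {a, b} F) ?oth ?Ps"
    unfolding path_system_def using sets lnks ballI[OF paths] by (intro conjI)
  then show ?thesis by blast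
qed

section \<open>Conflicts that exclude an order, and an order read off from paths\<close>

context row_graph
begin

text \<open>Ends of paths are mapped to ends, which are vertices and hence nonzero; so the value 0
  puts \<open>w\<close> inside its path. Its two links there and the new edge are three core edges
  at \<open>w\<close>.\<close>

lemma inner_vertex_not_orderable:
  assumes sys: "path_system V F oth Ps" and V: "0 \<notin> V"
    and F: "\<And>e. e \<in> F \<Longrightarrow> \<exists>y<n. core y \<and> edge y = e"
    and x: "x < n" "core x" "edge x \<notin> F" and w: "w \<in> edge x" "w \<in> V" "oth w = 0"
  shows "\<not> orderable n u v"
proof -
  obtain p where p: "p \<in> Ps" "w \<in> set p" using path_systemD(2)[OF sys] w(2) by blast
  have "set p \<subseteq> V" using p(1) path_systemD(2)[OF sys] by auto
  then have "hd p \<noteq> 0" "last p \<noteq> 0"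
    using V path_systemD(5)[OF sys p(1)] by (metis hd_in_set last_in_set subsetD)+
  then have "w \<noteq> hd p" "w \<noteq> last p"
    using w(3) path_systemD(7,8)[OF sys p(1)] by metis+
  then obtain a b where ab: "a \<noteq> b" "{w, a} \<in> links p" "{w, b} \<in> links p"
    using interior_neighbours path_systemD(6)[OF sys p(1)] p(2) by metis
  have "{w, a} \<in> F" "{w, b} \<in> F" using ab p(1) path_systemD(3)[OF sys] by auto
  then obtain y z where yz: "y < n" "core y" "edge y = {w, a}" "z < n" "core z" "edge z = {w, b}"
    using F by metis
  show ?thesis
  proof (rule three_core_edges_not_orderable[of x y z w])
    show "edge x \<noteq> edge y" "edge x \<noteq> edge z"
      using yz x(3) \<open>{w, a} \<in> F\<close> \<open>{w, b} \<in> F\<close> by metis+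
    show "edge y \<noteq> edge z" using yz ab(1) by (simp add: doubleton_eq_iff)
  qed (use x yz w in simp_all)
qed

text \<open>A nonzero value of \<open>oth\<close> marks an end, so \<open>x\<close> joins the two
  ends of one path. Since its edge is new, this closes a proper cycle, and the rows over the cycle
  form a leafless set.\<close>

lemma closing_edge_not_orderable:
  assumes sys: "path_system V F oth Ps" and V: "0 \<notin> V"
    and F: "\<And>e. e \<in> F \<Longrightarrow> \<exists>y<n. core y \<and> edge y = e"
    and x: "x < n" "edge x \<notin> F" "u x \<in> V" "v x \<in> V" "oth (u x) = v x"
  shows "\<not> orderable n u v"
proof -
  obtain p where p: "p \<in> Ps" "u x \<in> set p" using path_systemD(2)[OF sys] x(3) by blast
  have "oth (u x) \<noteq> 0" using x(4,5) V by metis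
  then have "u x = hd p \<or> u x = last p" using path_systemD(9)[OF sys p] by metis
  then have ends: "{hd p, last p} = edge x"
    using x(5) path_systemD(7,8)[OF sys p(1)] unfolding edge_def by auto
  have ne: "hd p \<noteq> last p" using ends bip[OF x(1) x(1)] unfolding edge_def by auto
  have lF: "links p \<subseteq> F" using p(1) path_systemD(3)[OF sys] by auto
  let ?C = "insert {hd p, last p} (links p)"
  let ?S = "{y. y < n \<and> edge y \<in> ?C}"
  have p0: "p \<noteq> []" "distinct p" using path_systemD(5,6)[OF sys p(1)] .
  show ?thesis
  proof (rule leafless_not_orderable[of ?S])
    show "?S \<noteq> {}" using x(1) ends by auto
    fix y w assume y: "y \<in> ?S" "w \<in> edge y"
    have "edge y \<subseteq> set p" using y(1) links_subset[of "edge y" p] p0 by auto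
    then have "w \<in> set p" using y(2) by blast
    moreover have "{hd p, last p} \<notin> links p" using lF x(2) unfolding ends by blast
    ultimately obtain a b where ab: "a \<noteq> b" "{w, a} \<in> ?C" "{w, b} \<in> ?C"
      using cycle_neighbours p0 ne by metis
    have "{w, a} \<noteq> edge y \<or> {w, b} \<noteq> edge y" using ab(1) by (metis doubleton_eq_iff)
    then obtain c where c: "{w, c} \<in> ?C" "{w, c} \<noteq> edge y" using ab by blast
    have "\<exists>z<n. edge z = {w, c}"
      using c(1) lF F ends x(1) by (metis insertE subsetD)
    then obtain z where "z < n" "edge z = {w, c}" by blast
    then show "\<exists>z\<in>?S. w \<in> edge z \<and> edge z \<noteq> edge y" using c by (intro bexI[of _ z]) auto
  qed auto
qed

text \<open>The concatenation of the paths lists the vertices \<open>W\<^sub>0, W\<^sub>1, \<dots>\<close>. The core edge between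
  \<open>W\<^sub>k\<close> and \<open>W\<^sub>k\<^sub>+\<^sub>1\<close> is placed at \<open>2k + 1\<close> and the leaves hanging off \<open>W\<^sub>k\<close> at \<open>2k\<close>, grouped
  by the leaf.\<close>

lemma path_system_imp_orderable:
  assumes sys: "path_system V F oth Ps"
    and V: "\<And>x. x < n \<Longrightarrow> edge x \<subseteq> V"
    and F: "\<And>x. x < n \<Longrightarrow> core x \<Longrightarrow> edge x \<in> F"
  shows "orderable n u v"
proof -
  obtain ps where ps: "set ps = Ps" "distinct ps"
    using finite_distinct_list[OF path_systemD(1)[OF sys]] by blast
  define W where "W = concat ps"
  have dW: "distinct W"
    unfolding W_def
    by (rule distinct_concat) (use ps path_systemD(4,6)[OF sys] in auto)
  have setW: "set W = V" using path_systemD(2)[OF sys] ps(1) by (simp add: W_def)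
  have "\<forall>w\<in>V. \<exists>k. k < length W \<and> W ! k = w" unfolding setW[symmetric] by (auto simp: in_set_conv_nth)
  then obtain pos where pos: "\<And>w. w \<in> V \<Longrightarrow> pos w < length W \<and> W ! pos w = w" by metis
  have pos_eq: "pos (W ! k) = k" if "k < length W" for k
    using pos[of "W ! k"] nth_eq_iff_index_eq[OF dW, of "pos (W ! k)" k] that nth_mem[OF that]
    by (simp add: setW)
  have pos_inj: "a = b" if "pos a = pos b" "a \<in> V" "b \<in> V" for a b
    using pos that by metis
  define m where "m x = min (pos (u x)) (pos (v x))" for x
  have uv: "u x \<in> V" "v x \<in> V" if "x < n" for x using V[OF that] by (auto simp: edge_def)
  have core_edge: "edge x = {W ! m x, W ! Suc (m x)} \<and> Suc (m x) < length W"
    if x: "x < n" "core x" for x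
  proof -
    have "edge x \<in> F" using F x by blast
    then obtain p where p: "p \<in> Ps" "edge x \<in> links p" using path_systemD(3)[OF sys] by auto
    have "[] \<notin> set ps" using path_systemD(5)[OF sys] ps(1) by auto
    then have "edge x \<in> links W" using links_concat[of p ps] p ps(1) by (auto simp: W_def)
    then obtain k where k: "Suc k < length W" "edge x = {W ! k, W ! Suc k}"
      using links_nth by blast
    have "pos (W ! k) = k" "pos (W ! Suc k) = Suc k" using pos_eq k(1) by auto
    moreover have "u x = W ! k \<and> v x = W ! Suc k \<or> u x = W ! Suc k \<and> v x = W ! k"
      using k(2) unfolding edge_def doubleton_eq_iff .
    ultimately have "m x = k" unfolding m_def by auto
    then show ?thesis using k by simp
  qed
  \<comment> \<open>\<open>c x\<close> is where a non-core row hangs and \<open>L x\<close> is its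
    leaf. If neither end is branching, the edge is a component of its own and \<open>u x\<close> is
    taken by default. Core rows need no leaf digit, because \<open>m x\<close> already determines
    their edge.\<close>
  define c where "c x = (if branching (v x) then v x else u x)" for x
  define K where "K x = (if core x then 2 * m x + 1 else 2 * pos (c x))" for x
  define L where "L x = (if core x then 0 else if branching (v x) then u x else v x)" for x
  have cV: "c x \<in> V" if "x < n" for x using uv[OF that] by (simp add: c_def)
  have noncore_edge: "edge x = {c x, L x}" if "\<not> core x" for x
    using that by (auto simp: c_def L_def edge_def)
  have key_inj: "edge x = edge y" if "x < n" "y < n" "K x = K y" "L x = L y" for x y
  proof -
    have "core x \<longleftrightarrow> core y"
    proof -
      have "even (K x) \<longleftrightarrow> \<not> core x" "even (K y) \<longleftrightarrow> \<not> core y" by (auto simp: K_def)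
      then show ?thesis using that(3) by metis
    qed
    moreover have ?thesis if xy: "core x" "core y"
    proof -
      have "m x = m y" using xy \<open>K x = K y\<close> by (simp add: K_def)
      then show ?thesis using core_edge[of x] core_edge[of y] xy \<open>x < n\<close> \<open>y < n\<close> by simp
    qed
    moreover have ?thesis if xy: "\<not> core x" "\<not> core y"
    proof -
      have "pos (c x) = pos (c y)" using xy \<open>K x = K y\<close> by (simp add: K_def)
      then have "c x = c y" using pos_inj cV \<open>x < n\<close> \<open>y < n\<close> by metis
      then show ?thesis using noncore_edge xy \<open>L x = L y\<close> by metis
    qed
    ultimately show ?thesis by blast
  qed
  \<comment> \<open>A vertex at position \<open>k\<close> owns the window from
    \<open>2 * k - 1\<close> to \<open>2 * k + 1\<close>: one core edge, its leaves, the other core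
    edge. Here rows at a branching vertex fall into its window; conversely, by
    \<open>covered\<close>, every row in the window contains the vertex. Contiguity at branching
    vertices is then a matter of intervals. The left bound is written with \<open>+ 1\<close> to
    avoid subtraction.\<close>
  have near: "K x \<le> 2 * pos w + 1 \<and> 2 * pos w \<le> K x + 1"
    if "x < n" "w \<in> edge x" "branching w" for x w
  proof (cases "core x")
    case True
    then have "w = W ! m x \<or> w = W ! Suc (m x)" "Suc (m x) < length W"
      using core_edge[of x] that by auto
    then have "pos w = m x \<or> pos w = Suc (m x)" using pos_eq by auto
    then show ?thesis using True by (auto simp: K_def)
  next
    case False
    then have "w = c x" using that(2,3) by (auto simp: c_def core_def edge_def)
    then show ?thesis using False by (simp add: K_def)
  qed
  have covered: "w \<in> edge y"
    if "y < n" "w \<in> V" "K y \<le> 2 * pos w + 1" "2 * pos w \<le> K y + 1" for y w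
  proof (cases "core y")
    case True
    then have "pos w = m y \<or> pos w = Suc (m y)" using that(3,4) by (auto simp: K_def)
    then have "w = W ! m y \<or> w = W ! Suc (m y)" using pos[OF that(2)] by auto
    then show ?thesis using core_edge[OF that(1) True] by auto
  next
    case False
    then have "pos w = pos (c y)" using that(3,4) by (simp add: K_def)
    then have "w = c y" using pos_inj that(2) cV[OF that(1)] by blast
    then show ?thesis using noncore_edge[OF False] by simp
  qed
  \<comment> \<open>The number of a row has three digits: \<open>K\<close>, then \<open>L\<close> to
    a base above all its values, then the row itself. The last digit gives injectivity and only
    separates rows with equal \<open>K\<close> and \<open>L\<close>, that is, copies of one
    edge.\<close>
  define M where "M = Suc (\<Sum>x<n. u x + v x)"
  have LM: "L x < M" if "x < n" for x
  proof -
    have "u x + v x \<le> (\<Sum>x<n. u x + v x)" by (rule member_le_sum) (use that in auto)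
    then show ?thesis by (simp add: M_def L_def)
  qed
  define S where "S x = K x * M + L x" for x
  define p where "p x = S x * n + x" for x
  have S_le: "S x \<le> S y" if "p x < p y" "y < n" for x y
    using lex_le[of "S x" n x "S y" y] that by (simp add: p_def)
  have K_le: "K x \<le> K y" if "S x \<le> S y" "y < n" for x y
    using lex_le[of "K x" M "L x" "K y" "L y"] that LM by (simp add: S_def)
  have "inj_on p {..<n}"
  proof (rule inj_onI)
    fix x y assume xy: "x \<in> {..<n}" "y \<in> {..<n}" "p x = p y"
    have "p z mod n = z" if "z < n" for z using that by (simp add: p_def)
    then show "x = y" using xy by (metis lessThan_iff)
  qed
  moreover have "edge_convex p"
    unfolding edge_convex_def
  proof (intro allI impI)
    fix x y z w
    assume xyz: "x < n" "y < n" "z < n" and lt: "p x < p y" "p y < p z"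
      and w: "w \<in> edge x" "w \<in> edge z"
    have Sle: "S x \<le> S y" "S y \<le> S z" using S_le lt xyz by auto
    have Kle: "K x \<le> K y" "K y \<le> K z" using K_le Sle xyz by auto
    show "w \<in> edge y"
    proof (cases "branching w")
      case True
      show ?thesis
        by (rule covered[OF xyz(2)])
          (use V w(1) xyz(1) near[OF xyz(1) w(1) True] near[OF xyz(3) w(2) True] Kle in auto)
    next
      case False
      \<comment> \<open>At a vertex that is not branching, both outer rows have the same edge, hence
        the same upper digits, and the row squeezed between them shares these and so the
        edge.\<close>
      then have "edge x = edge z" using w xyz unfolding branching_def by blast
      then have "u x = u z" "v x = v z" using edge_eq_iff xyz by auto
      then have "K x = K z" "L x = L z" by (auto simp: K_def L_def core_def c_def m_def)
      then have "K x = K y" "L x = L y" using Kle Sle by (auto simp: S_def)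
      then show ?thesis using key_inj[OF xyz(1,2)] w(1) by simp
    qed
  qed
  ultimately show ?thesis unfolding orderable_iff_edge_convex by blast
qed

end

section \<open>Executing programs\<close>

notation Seq (infixr ";;" 60)

fun loop_free :: "com \<Rightarrow> bool" where
  "loop_free (Seq c d) \<longleftrightarrow> loop_free c \<and> loop_free d"
| "loop_free (IfEq x y c d) \<longleftrightarrow> loop_free c \<and> loop_free d"
| "loop_free (WhileNeq x y c) \<longleftrightarrow> False"
| "loop_free c \<longleftrightarrow> True"

text \<open>Only an upper bound is needed, so both branches of a test are added up. The value for
  loops is a dummy: \<open>exec_ev\<close> speaks of loop-free programs only.\<close>

fun cost :: "com \<Rightarrow> nat" where
  "cost (Seq c d) = cost c + cost d"
| "cost (IfEq x y c d) = 1 + cost c + cost d"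
| "cost c = 1"

text \<open>Straight-line code becomes a function that simplification can run symbolically; on loops
  it is a dummy.\<close>

fun ev :: "com \<Rightarrow> 'v state \<Rightarrow> 'v state" where
  "ev (Const x k) s = set_reg x (Num k) s"
| "ev (Copy x y) s = set_reg x (reg s y) s"
| "ev (Inc x) s = set_reg x (map_num Suc (reg s x)) s"
| "ev (Dec x) s = set_reg x (map_num (\<lambda>k. k - 1) (reg s x)) s"
| "ev (Get x h y z) s = set_reg x (tab s h (reg s y) (reg s z)) s"
| "ev (Put h y z x) s = set_tab h (reg s y) (reg s z) (reg s x) s"
| "ev (Seq c d) s = ev d (ev c s)"
| "ev (IfEq x y c d) s = (if reg s x = reg s y then ev c s else ev d s)"
| "ev (WhileNeq x y c) s = s"

lemma reg_tab_update [simp]: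
  "reg (set_reg x w s) = (reg s)(x := w)"
  "tab (set_reg x w s) = tab s"
  "reg (set_tab h k l w s) = reg s"
  "tab (set_tab h k l w s) = (tab s)(h := (tab s h)(k := (tab s h k)(l := w)))"
  by (simp_all add: set_reg_def set_tab_def)

text \<open>A bound instead of the exact time, so that branches of different length need no
  distinction.\<close>

definition halts :: "com \<Rightarrow> 'v state \<Rightarrow> nat \<Rightarrow> 'v state \<Rightarrow> bool" where
  "halts c s t s' \<longleftrightarrow> (\<exists>t'\<le>t. exec c s t' s')"

lemma halts_mono: "halts c s t s' \<Longrightarrow> t \<le> u \<Longrightarrow> halts c s u s'"
  unfolding halts_def by (meson order_trans)

lemma halts_Seq:
  assumes "halts c s t s'" "halts d s' u s''"
  shows "halts (c ;; d) s (t + u) s''"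
proof -
  obtain t' u' where "t' \<le> t" "exec c s t' s'" "u' \<le> u" "exec d s' u' s''"
    using assms unfolding halts_def by blast
  then show ?thesis
    unfolding halts_def by (intro exI[of _ "t' + u'"] conjI add_mono exec.Seq)
qed

lemma exec_ev: "loop_free c \<Longrightarrow> \<exists>t\<le>cost c. exec c s t (ev c s)"
proof (induction c arbitrary: s)
  case (Seq c d)
  then obtain t u where "t \<le> cost c" "exec c s t (ev c s)"
      "u \<le> cost d" "exec d (ev c s) u (ev d (ev c s))"
    by (metis loop_free.simps(1))
  then show ?case by (intro exI[of _ "t + u"]) (auto intro: exec.Seq)
next
  case (IfEq x y c d)
  show ?case
  proof (cases "reg s x = reg s y")
    case True
    obtain t where t: "t \<le> cost c" "exec c s t (ev c s)" using IfEq by force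
    show ?thesis using t(1) exec.IfTrue[OF True t(2)] True by (intro exI[of _ "1 + t"]) simp
  next
    case False
    obtain t where t: "t \<le> cost d" "exec d s t (ev d s)" using IfEq by force
    show ?thesis using t(1) exec.IfFalse[OF False t(2)] False by (intro exI[of _ "1 + t"]) simp
  qed
qed (simp_all, (rule exI[of _ "Suc 0"], simp add: exec.intros(1-6)[unfolded One_nat_def])+)

lemma halts_ev: "loop_free c \<Longrightarrow> halts c s (cost c) (ev c s)"
  unfolding halts_def by (rule exec_ev)

text \<open>Each round pays for the body and one test; the final \<open>+ 1\<close> is the test that
  leaves the loop.\<close>

lemma halts_for:
  assumes guard: "\<And>i s. I i s \<Longrightarrow> reg s x = Num i \<and> reg s y = Num n"
    and body: "\<And>i s. I i s \<Longrightarrow> i < n \<Longrightarrow> \<exists>s'. halts c s t s' \<and> I (Suc i) s'"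
    and init: "I 0 s"
  shows "\<exists>s'. halts (WhileNeq x y c) s (n * (t + 1) + 1) s' \<and> I n s'"
proof -
  \<comment> \<open>Induction on the number \<open>d\<close> of remaining rounds.\<close>
  have "\<exists>s'. halts (WhileNeq x y c) s (d * (t + 1) + 1) s' \<and> I n s'"
    if "I i s" "i + d = n" for i d s
    using that
  proof (induction d arbitrary: i s)
    case 0
    then have "exec (WhileNeq x y c) s 1 s" using guard by (intro exec.WhileFalse) auto
    then show ?case using 0 unfolding halts_def by (intro exI[of _ s]) auto
  next
    case (Suc d)
    then have "i < n" by simp
    then obtain s1 where s1: "halts c s t s1" "I (Suc i) s1" using body Suc.prems(1) by blast
    then obtain s2 where s2: "halts (WhileNeq x y c) s1 (d * (t + 1) + 1) s2" "I n s2"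
      using Suc.IH[of "Suc i" s1] Suc.prems(2) by auto
    obtain a b where ab: "a \<le> t" "exec c s a s1"
        "b \<le> d * (t + 1) + 1" "exec (WhileNeq x y c) s1 b s2"
      using s1(1) s2(1) unfolding halts_def by blast
    have "reg s x \<noteq> reg s y" using guard[OF Suc.prems(1)] \<open>i < n\<close> by simp
    then have "exec (WhileNeq x y c) s (1 + a + b) s2" using ab by (intro exec.WhileTrue)
    moreover have "1 + a + b \<le> Suc d * (t + 1) + 1" using ab by simp
    ultimately show ?case using s2(2) unfolding halts_def by blast
  qed
  from this[of 0 s n] show ?thesis using init by simp
qed

section \<open>The program\<close>

text \<open>
  Registers: 4 and 5 hold the constants 0 and 1, 6 the current row, 8 the current node of the
  trie of \<open>X\<close>-projections, 11 the last number handed out, 12 and 13 the two vertices of the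
  current row, 16 the verdict.

  Tables: 2 holds the trie, whose leaves are extended by the \<open>A\<close>-values, and 3 its extension by
  the \<open>B\<close>-values, both numbered from the same counter; 4 and 5 hold the two vertices of each
  row, 6 some neighbour of each vertex, 7 the branching flags, 8 the core edges seen so far, 9
  the opposite end of each path.
\<close>

definition ids :: "(nat \<Rightarrow> 'v wrd \<Rightarrow> 'v wrd \<Rightarrow> 'v wrd) \<Rightarrow> nat \<Rightarrow> bool" where
  "ids T c \<longleftrightarrow>
     (\<forall>h\<in>{2, 3}. \<forall>k l. \<exists>a\<le>c. T h k l = Num a) \<and>
     (\<forall>h\<in>{2, 3}. \<forall>h'\<in>{2, 3}. \<forall>k l k' l'. T h k l = T h' k' l' \<longrightarrow> T h k l \<noteq> Num 0 \<longrightarrow>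
        h = h' \<and> k = k' \<and> l = l')"

text \<open>Facts about earlier rows rest on entries already present, so they survive as long as the
  tables only grow.\<close>

definition extends :: "(nat \<Rightarrow> 'v wrd \<Rightarrow> 'v wrd \<Rightarrow> 'v wrd) \<Rightarrow>
    (nat \<Rightarrow> 'v wrd \<Rightarrow> 'v wrd \<Rightarrow> 'v wrd) \<Rightarrow> bool" where
  "extends T T' \<longleftrightarrow> (\<forall>h\<in>{2, 3}. \<forall>k l. T h k l \<noteq> Num 0 \<longrightarrow> T' h k l = T h k l)"

lemma extends_trans: "extends T T' \<Longrightarrow> extends T' T'' \<Longrightarrow> extends T T''"
  unfolding extends_def by metis

lemma ids_Num: "ids T c \<Longrightarrow> h \<in> {2, 3} \<Longrightarrow> \<exists>a\<le>c. T h k l = Num a"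
  unfolding ids_def by blast

lemma ids_inj:
  "ids T c \<Longrightarrow> h \<in> {2, 3} \<Longrightarrow> h' \<in> {2, 3} \<Longrightarrow> T h k l = T h' k' l' \<Longrightarrow> T h k l \<noteq> Num 0 \<Longrightarrow>
    h = h' \<and> k = k' \<and> l = l'"
  unfolding ids_def by blast

lemma ids_insert:
  assumes T: "ids T c" and h: "h \<in> {2, 3}"
  shows "ids (T(h := (T h)(k := (T h k)(l := Num (Suc c))))) (Suc c)"
proof -
  let ?T = "T(h := (T h)(k := (T h k)(l := Num (Suc c))))"
  have eq: "?T g x y = (if g = h \<and> x = k \<and> y = l then Num (Suc c) else T g x y)" for g x y
    by simp
  have new: "T g x y \<noteq> Num (Suc c)" if "g \<in> {2, 3}" for g x y
    using ids_Num[OF T that, of x y] by auto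
  show ?thesis
    unfolding ids_def
  proof (intro conjI ballI allI impI)
    fix g x y assume g: "g \<in> {2, 3::nat}"
    obtain a where "a \<le> c" "T g x y = Num a" using ids_Num[OF T g] by blast
    then show "\<exists>a\<le>Suc c. ?T g x y = Num a" unfolding eq by (metis le_SucI order_refl)
  next
    fix g g' x y x' y'
    assume "g \<in> {2, 3::nat}" "g' \<in> {2, 3::nat}" and e: "?T g x y = ?T g' x' y'" "?T g x y \<noteq> Num 0"
    then have "g = g' \<and> x = x' \<and> y = y'"
      unfolding eq using new[of g x y] new[of g' x' y'] ids_inj[OF T, of g g' x y x' y']
      by (auto split: if_splits)
    then show "g = g'" "x = x'" "y = y'" by auto
  qed
qed

text \<open>Hash-consing: a known pair of node and label yields its old number, a new pair the next
  one. \<open>Copy 4 4\<close> does nothing and stands for an empty branch.\<close>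

definition intern :: "nat \<Rightarrow> com" where
  "intern h = Get 10 h 8 9 ;; IfEq 10 4 (Inc 11 ;; Copy 10 11 ;; Put h 8 9 10) (Copy 4 4)"

lemma ev_intern:
  assumes r: "reg s 4 = Num 0" "reg s 11 = Num c" and T: "ids (tab s) c" and h: "h \<in> {2, 3}"
  defines "s' \<equiv> ev (intern h) s"
  shows "\<exists>c'. reg s' 11 = Num c' \<and> ids (tab s') c'" "extends (tab s) (tab s')"
    "reg s' 10 = tab s' h (reg s 8) (reg s 9)" "reg s' 10 \<noteq> Num 0"
    "\<And>x. x \<noteq> 10 \<Longrightarrow> x \<noteq> 11 \<Longrightarrow> reg s' x = reg s x"
    "\<And>g. g \<noteq> 2 \<Longrightarrow> g \<noteq> 3 \<Longrightarrow> tab s' g = tab s g"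
proof -
  let ?k = "reg s 8" and ?l = "reg s 9"
  have "(\<exists>c'. reg s' 11 = Num c' \<and> ids (tab s') c') \<and> extends (tab s) (tab s') \<and>
    reg s' 10 = tab s' h ?k ?l \<and> reg s' 10 \<noteq> Num 0 \<and>
    (\<forall>x. x \<noteq> 10 \<longrightarrow> x \<noteq> 11 \<longrightarrow> reg s' x = reg s x) \<and>
    (\<forall>g. g \<noteq> 2 \<longrightarrow> g \<noteq> 3 \<longrightarrow> tab s' g = tab s g)"
  proof (cases "tab s h ?k ?l = Num 0")
    case True
    have t: "tab s' = (tab s)(h := (tab s h)(?k := (tab s h ?k)(?l := Num (Suc c))))"
      and r': "reg s' = (reg s)(11 := Num (Suc c), 10 := Num (Suc c))"
      using True r by (auto simp: s'_def intern_def)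
    have "extends (tab s) (tab s')" unfolding t extends_def using True by auto
    moreover have "ids (tab s') (Suc c)" unfolding t by (rule ids_insert[OF T h])
    moreover have "\<forall>g. g \<noteq> 2 \<longrightarrow> g \<noteq> 3 \<longrightarrow> tab s' g = tab s g" using h by (auto simp: t)
    ultimately show ?thesis by (simp add: r' t)
  next
    case False
    have t: "tab s' = tab s" and r': "reg s' = (reg s)(10 := tab s h ?k ?l)"
      using False r by (auto simp: s'_def intern_def)
    then show ?thesis using False T r by (simp add: extends_def)
  qed
  then show "\<exists>c'. reg s' 11 = Num c' \<and> ids (tab s') c'" "extends (tab s) (tab s')"
    "reg s' 10 = tab s' h (reg s 8) (reg s 9)" "reg s' 10 \<noteq> Num 0"
    "\<And>x. x \<noteq> 10 \<Longrightarrow> x \<noteq> 11 \<Longrightarrow> reg s' x = reg s x"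
    "\<And>g. g \<noteq> 2 \<Longrightarrow> g \<noteq> 3 \<Longrightarrow> tab s' g = tab s g"
    by blast+
qed

text \<open>Walks in a trie kept as a table of children. The root will be \<open>Num 0\<close>,
  which cannot be confused with a child, since children are nonzero.\<close>

fun trace :: "('v wrd \<Rightarrow> 'v wrd \<Rightarrow> 'v wrd) \<Rightarrow> 'v wrd \<Rightarrow> 'v wrd list \<Rightarrow> 'v wrd \<Rightarrow> bool" where
  "trace t k [] k' \<longleftrightarrow> k' = k"
| "trace t k (w # ws) k' \<longleftrightarrow> t k w \<noteq> Num 0 \<and> trace t (t k w) ws k'"

lemma trace_snoc:
  "trace t k (ws @ [w]) k' \<longleftrightarrow> (\<exists>k''. trace t k ws k'' \<and> t k'' w \<noteq> Num 0 \<and> k' = t k'' w)"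
  by (induction ws arbitrary: k) auto

lemma trace_extends: "extends T T' \<Longrightarrow> trace (T 2) k ws k' \<Longrightarrow> trace (T' 2) k ws k'"
  by (induction ws arbitrary: k) (auto simp: extends_def)

text \<open>A node determines its parent and its last label, so the words are compared from the
  back; equal length lets both reach the root together.\<close>

lemma trace_inj:
  assumes T: "ids T c"
  shows "trace (T 2) (Num 0) ws a \<Longrightarrow> trace (T 2) (Num 0) ws' a' \<Longrightarrow> length ws = length ws' \<Longrightarrow>
    a = a' \<longleftrightarrow> ws = ws'"
proof (induction ws arbitrary: ws' a a' rule: rev_induct)
  case (snoc w ws)
  then obtain x xs where ws': "ws' = xs @ [x]" "length ws = length xs"
    by (cases ws' rule: rev_cases) auto
  obtain k where k: "trace (T 2) (Num 0) ws k" "T 2 k w \<noteq> Num 0" "a = T 2 k w"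
    using snoc.prems(1) unfolding trace_snoc by blast
  obtain l where l: "trace (T 2) (Num 0) xs l" "T 2 l x \<noteq> Num 0" "a' = T 2 l x"
    using snoc.prems(2) unfolding ws'(1) trace_snoc by blast
  have "a = a' \<longleftrightarrow> k = l \<and> w = x" using ids_inj[OF T, of 2 2 k w l x] k l by auto
  also have "\<dots> \<longleftrightarrow> ws @ [w] = ws'" using snoc.IH[OF k(1) l(1) ws'(2)] ws'(1) by auto
  finally show ?case .
qed auto

lemma trace_Num: "ids T c \<Longrightarrow> trace (T 2) (Num 0) ws k \<Longrightarrow> \<exists>a. k = Num a"
  by (cases ws rule: rev_cases) (auto simp: trace_snoc dest!: ids_Num[of T c 2])

text \<open>Register 7 counts the attributes of \<open>X\<close>, and 9 receives first the attribute
  and then the cell, which is the label to follow.\<close>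

definition descend :: com where
  "descend = Get 9 1 7 4 ;; Get 9 0 6 9 ;; intern 2 ;; Copy 8 10 ;; Inc 7"

definition number_row :: com where
  "number_row = (Const 8 0 ;; Const 7 0) ;; WhileNeq 7 1 descend ;;
     (Get 9 0 6 2 ;; intern 2 ;; Put 4 6 4 10 ;; Get 9 0 6 3 ;; intern 3 ;; Put 5 6 4 10 ;; Inc 6)"

section \<open>Numbering the vertices of all rows\<close>

locale table_input =
  fixes r :: "'v list list" and X :: "nat list" and A B m :: nat
  assumes table: "is_table m r" and X: "distinct X" "set X \<subseteq> {..<m}" and AB: "A < m" "B < m"
begin

definition row_key :: "nat \<Rightarrow> 'v wrd list" where
  "row_key i = map (\<lambda>C. Val (val r C i)) X"

definition ready :: "'v state \<Rightarrow> bool" where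
  "ready s \<longleftrightarrow> reg s 0 = Num (length r) \<and> reg s 1 = Num (length X) \<and> reg s 2 = Num A \<and>
     reg s 3 = Num B \<and> reg s 4 = Num 0 \<and> tab s 0 = cell r \<and> tab s 1 = attr_entry X \<and>
     (\<exists>c. reg s 11 = Num c \<and> ids (tab s) c)"

lemma ready_cong:
  assumes "ready s" "\<And>x. x \<in> {0, 1, 2, 3, 4, 11} \<Longrightarrow> reg s' x = reg s x"
    "\<And>h. h \<in> {0, 1, 2, 3} \<Longrightarrow> tab s' h = tab s h"
  shows "ready s'"
proof -
  have "ids (tab s') c = ids (tab s) c" for c unfolding ids_def using assms(3) by simp
  then show ?thesis using assms unfolding ready_def by simp
qed

lemma ready_intern:
  assumes s: "ready s" and h: "h \<in> {2, 3}"
  defines "s' \<equiv> ev (intern h) s"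
  shows "ready s'" "extends (tab s) (tab s')"
    "reg s' 10 = tab s' h (reg s 8) (reg s 9)" "reg s' 10 \<noteq> Num 0"
    "\<And>x. x \<noteq> 10 \<Longrightarrow> x \<noteq> 11 \<Longrightarrow> reg s' x = reg s x"
    "\<And>g. g \<noteq> 2 \<Longrightarrow> g \<noteq> 3 \<Longrightarrow> tab s' g = tab s g"
proof -
  obtain c where c: "reg s 4 = Num 0" "reg s 11 = Num c" "ids (tab s) c"
    using s unfolding ready_def by blast
  note I = ev_intern[OF c h, folded s'_def]
  show "extends (tab s) (tab s')"
    "reg s' 10 = tab s' h (reg s 8) (reg s 9)" "reg s' 10 \<noteq> Num 0"
    "\<And>x. x \<noteq> 10 \<Longrightarrow> x \<noteq> 11 \<Longrightarrow> reg s' x = reg s x"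
    "\<And>g. g \<noteq> 2 \<Longrightarrow> g \<noteq> 3 \<Longrightarrow> tab s' g = tab s g"
    by (fact I)+
  show "ready s'" using s I(1) unfolding ready_def by (simp add: I(5,6))
qed

lemma cell_eq: "i < length r \<Longrightarrow> C < m \<Longrightarrow> cell r (Num i) (Num C) = Val (val r C i)"
  using table unfolding is_table_def by simp

lemma descend_loop:
  assumes s: "ready s" and i: "reg s 6 = Num i" "i < length r" and init: "reg s 8 = Num 0" "reg s 7 = Num 0"
  shows "\<exists>s'. halts (WhileNeq 7 1 descend) s (length X * (cost descend + 1) + 1) s' \<and>
    ready s' \<and> reg s' 6 = Num i \<and> extends (tab s) (tab s') \<and>
    (\<forall>h. h \<noteq> 2 \<longrightarrow> h \<noteq> 3 \<longrightarrow> tab s' h = tab s h) \<and> trace (tab s' 2) (Num 0) (row_key i) (reg s' 8)"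
proof -
  define I where "I j s' \<longleftrightarrow> ready s' \<and> reg s' 7 = Num j \<and> reg s' 6 = Num i \<and>
      extends (tab s) (tab s') \<and> (\<forall>h. h \<noteq> 2 \<longrightarrow> h \<noteq> 3 \<longrightarrow> tab s' h = tab s h) \<and>
      trace (tab s' 2) (Num 0) (take j (row_key i)) (reg s' 8)" for j s'
  have "\<exists>s'. halts (WhileNeq 7 1 descend) s (length X * (cost descend + 1) + 1) s' \<and>
      I (length X) s'"
  proof (rule halts_for)
    show "reg s' 7 = Num j \<and> reg s' 1 = Num (length X)" if "I j s'" for j s'
      using that unfolding I_def ready_def by blast
    show "I 0 s" using s i(1) init by (simp add: I_def extends_def)
    fix j s1 assume I: "I j s1" and j: "j < length X"
    define s2 where "s2 = ev (Get 9 1 7 4 ;; Get 9 0 6 9) s1"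
    define s3 where "s3 = ev (intern 2) s2"
    define s4 where "s4 = ev (Copy 8 10 ;; Inc 7) s3"
    have r1: "ready s1" "reg s1 7 = Num j" "reg s1 6 = Num i" using I unfolding I_def by auto
    have "X ! j < m" using X(2) j nth_mem by blast
    then have s2: "reg s2 = (reg s1)(9 := Val (val r (X ! j) i))" "tab s2 = tab s1"
      using r1 j cell_eq[OF i(2)] unfolding s2_def ready_def by auto
    have r2: "ready s2" by (rule ready_cong[OF r1(1)]) (auto simp: s2)
    note R = ready_intern[OF r2, of 2, folded s3_def, simplified]
    have r4: "ready s4" by (rule ready_cong[OF R(1)]) (auto simp: s4_def)
    have "take (Suc j) (row_key i) = take j (row_key i) @ [Val (val r (X ! j) i)]"
      using j by (simp add: row_key_def take_Suc_conv_app_nth)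
    \<comment> \<open>Interning the next label only adds entries, so the walk made so far stays
      valid.\<close>
    moreover have "trace (tab s3 2) (Num 0) (take j (row_key i)) (reg s1 8)"
      by (rule trace_extends[of "tab s2"]) (use R(2) I in \<open>simp_all add: I_def s2\<close>)
    ultimately have "trace (tab s4 2) (Num 0) (take (Suc j) (row_key i)) (reg s4 8)"
      using R(3,4) by (auto simp: trace_snoc s4_def s2)
    moreover have "extends (tab s) (tab s4)"
      using extends_trans[of "tab s" "tab s1" "tab s3"] R(2) I by (simp add: I_def s2 s4_def)
    moreover have "tab s4 h = tab s h" if "h \<noteq> 2" "h \<noteq> 3" for h
      using R(6)[OF that] I that unfolding I_def by (simp add: s2 s4_def)
    moreover have "reg s4 7 = Num (Suc j)" "reg s4 6 = Num i"
      using R(5) r1 by (auto simp: s4_def s2)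
    ultimately have "I (Suc j) s4" using r4 unfolding I_def by blast
    moreover have "ev descend s1 = s4" by (simp add: descend_def s4_def s3_def s2_def)
    moreover have "loop_free descend" by (simp add: descend_def intern_def)
    ultimately show "\<exists>s'. halts descend s1 (cost descend) s' \<and> I (Suc j) s'"
      using halts_ev by metis
  qed
  then show ?thesis unfolding I_def by (auto simp: row_key_def)
qed

text \<open>The \<open>B\<close>-child lives in a table of its own, so that equal \<open>A\<close>-
  and \<open>B\<close>-values still give two vertices. The \<open>A\<close>-children can share table
  2 with the trie because they lie one level below its leaves.\<close>

definition numbered :: "(nat \<Rightarrow> 'v wrd \<Rightarrow> 'v wrd \<Rightarrow> 'v wrd) \<Rightarrow> nat \<Rightarrow> 'v wrd \<Rightarrow> bool" where
  "numbered T i k \<longleftrightarrow> trace (T 2) (Num 0) (row_key i) k \<and>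
     T 2 k (Val (val r A i)) \<noteq> Num 0 \<and> T 4 (Num i) (Num 0) = T 2 k (Val (val r A i)) \<and>
     T 3 k (Val (val r B i)) \<noteq> Num 0 \<and> T 5 (Num i) (Num 0) = T 3 k (Val (val r B i))"

lemma numbered_extends:
  "numbered T i k \<Longrightarrow> extends T T' \<Longrightarrow> T' 4 (Num i) (Num 0) = T 4 (Num i) (Num 0) \<Longrightarrow>
    T' 5 (Num i) (Num 0) = T 5 (Num i) (Num 0) \<Longrightarrow> numbered T' i k"
  using trace_extends[of T T'] unfolding numbered_def extends_def by auto

lemma number_row:
  assumes s: "ready s" and i: "reg s 6 = Num i" "i < length r"
  shows "\<exists>s'. halts number_row s (2 + (length X * (cost descend + 1) + 1 + (2 * cost (intern 2) + 5))) s' \<and>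
    ready s' \<and> reg s' 6 = Num (Suc i) \<and> extends (tab s) (tab s') \<and>
    (\<forall>h. h \<notin> {2, 3, 4, 5} \<longrightarrow> tab s' h = tab s h) \<and>
    (\<forall>j. j \<noteq> i \<longrightarrow> tab s' 4 (Num j) = tab s 4 (Num j) \<and> tab s' 5 (Num j) = tab s 5 (Num j)) \<and>
    (\<exists>k. numbered (tab s') i k)"
proof -
  define s0 where "s0 = ev (Const 8 0 ;; Const 7 0) s"
  have r0: "ready s0" by (rule ready_cong[OF s]) (auto simp: s0_def)
  have "\<exists>s'. halts (WhileNeq 7 1 descend) s0 (length X * (cost descend + 1) + 1) s' \<and>
    ready s' \<and> reg s' 6 = Num i \<and> extends (tab s0) (tab s') \<and>
    (\<forall>h. h \<noteq> 2 \<longrightarrow> h \<noteq> 3 \<longrightarrow> tab s' h = tab s0 h) \<and> trace (tab s' 2) (Num 0) (row_key i) (reg s' 8)"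
    by (rule descend_loop[OF r0]) (use i in \<open>simp_all add: s0_def\<close>)
  then obtain s1 where h1: "halts (WhileNeq 7 1 descend) s0 (length X * (cost descend + 1) + 1) s1"
    and r1: "ready s1" "reg s1 6 = Num i" "extends (tab s) (tab s1)"
      "\<forall>h. h \<noteq> 2 \<longrightarrow> h \<noteq> 3 \<longrightarrow> tab s1 h = tab s h"
    and tr1: "trace (tab s1 2) (Num 0) (row_key i) (reg s1 8)"
    by (auto simp: s0_def)
  define k where "k = reg s1 8"
  define s2 where "s2 = ev (Get 9 0 6 2) s1"
  define s3 where "s3 = ev (intern 2) s2"
  define s4 where "s4 = ev (Put 4 6 4 10 ;; Get 9 0 6 3) s3"
  define s5 where "s5 = ev (intern 3) s4"
  define s6 where "s6 = ev (Put 5 6 4 10 ;; Inc 6) s5"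
  let ?tail = "Get 9 0 6 2 ;; intern 2 ;; Put 4 6 4 10 ;; Get 9 0 6 3 ;; intern 3 ;; Put 5 6 4 10 ;; Inc 6"
  have s2: "reg s2 = (reg s1)(9 := Val (val r A i))" "tab s2 = tab s1"
    using r1 cell_eq[OF i(2) AB(1)] unfolding s2_def ready_def by auto
  have r2: "ready s2" by (rule ready_cong[OF r1(1)]) (auto simp: s2)
  note R3 = ready_intern[OF r2, of 2, folded s3_def, simplified]
  have s3: "reg s3 3 = Num B" "reg s3 6 = Num i" "reg s3 4 = Num 0" "tab s3 0 = cell r" "reg s3 8 = k"
    using R3(1,5,6) r1(2) unfolding ready_def by (auto simp: s2 k_def)
  have s4: "reg s4 = (reg s3)(9 := Val (val r B i))"
      "tab s4 = (tab s3)(4 := (tab s3 4)(Num i := (tab s3 4 (Num i))(Num 0 := reg s3 10)))"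
    using s3 cell_eq[OF i(2) AB(2)] by (auto simp: s4_def)
  have r4: "ready s4" by (rule ready_cong[OF R3(1)]) (auto simp: s4)
  note R5 = ready_intern[OF r4, of 3, folded s5_def, simplified]
  have s5: "reg s5 6 = Num i" "reg s5 4 = Num 0"
    using R5(1,5) s3(2) unfolding ready_def by (auto simp: s4)
  have s6: "reg s6 = (reg s5)(6 := Num (Suc i))"
      "tab s6 = (tab s5)(5 := (tab s5 5)(Num i := (tab s5 5 (Num i))(Num 0 := reg s5 10)))"
    using s5 by (auto simp: s6_def)
  have r6: "ready s6" by (rule ready_cong[OF R5(1)]) (auto simp: s6)
  have e13: "extends (tab s1) (tab s3)" using R3(2) by (simp add: s2)
  have e35: "extends (tab s3) (tab s5)" using R5(2) by (simp add: s4 extends_def)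
  have e56: "extends (tab s5) (tab s6)" by (simp add: s6 extends_def)
  have e16: "extends (tab s1) (tab s6)" using extends_trans e13 e35 e56 by blast
  have e36: "extends (tab s3) (tab s6)" using extends_trans e35 e56 by blast
  have a: "reg s3 10 = tab s3 2 k (Val (val r A i))" using R3(3) by (simp add: s2 k_def)
  have b: "reg s5 10 = tab s5 3 k (Val (val r B i))" using R5(3) s3(5) by (simp add: s4)
  have "tab s6 2 k (Val (val r A i)) = reg s3 10"
    using e36 a R3(4) unfolding extends_def by auto
  moreover have "tab s6 3 k (Val (val r B i)) = reg s5 10"
    using b by (simp add: s6)
  moreover have "tab s6 4 (Num i) (Num 0) = reg s3 10" "tab s6 5 (Num i) (Num 0) = reg s5 10"
    using R5(6)[of 4] by (simp_all add: s6 s4)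
  moreover have "trace (tab s6 2) (Num 0) (row_key i) k"
    using trace_extends[OF e16] tr1 by (simp add: k_def)
  ultimately have num: "numbered (tab s6) i k"
    unfolding numbered_def using R3(4) R5(4) by simp
  have same: "tab s6 h = tab s h" if "h \<notin> {2, 3, 4, 5}" for h
    using that R5(6)[of h] R3(6)[of h] r1(4) by (simp add: s6 s4 s2)
  have rows: "tab s6 4 (Num j) = tab s 4 (Num j) \<and> tab s6 5 (Num j) = tab s 5 (Num j)"
    if "j \<noteq> i" for j
    using that R5(6)[of 4] R5(6)[of 5] R3(6)[of 4] R3(6)[of 5] r1(4) by (simp add: s6 s4 s2)
  have tail: "ev ?tail s1 = s6" by (simp add: s6_def s5_def s4_def s3_def s2_def)
  \<comment> \<open>The cost of \<open>intern\<close> does not depend on the table, so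
    \<open>intern 2\<close> stands for both calls.\<close>
  have "cost ?tail = 2 * cost (intern 2) + 5" by (simp add: intern_def)
  moreover have "loop_free ?tail" by (simp add: intern_def)
  ultimately have htail: "halts ?tail s1 (2 * cost (intern 2) + 5) s6"
    using halts_ev[of ?tail s1] by (simp only: tail)
  have hpre: "halts (Const 8 0 ;; Const 7 0) s 2 s0"
    using halts_ev[of "Const 8 0 ;; Const 7 0" s] by (simp add: s0_def numeral_2_eq_2)
  have "halts number_row s
      (2 + (length X * (cost descend + 1) + 1 + (2 * cost (intern 2) + 5))) s6"
    unfolding number_row_def by (rule halts_Seq[OF hpre halts_Seq[OF h1 htail]])
  moreover have "extends (tab s) (tab s6)" using extends_trans[OF r1(3) e16] .
  moreover have "reg s6 6 = Num (Suc i)" by (simp add: s6)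
  ultimately show ?thesis using r6 same rows num by blast
qed

text \<open>Makes the cost of a row depend on the width of the table only, whatever \<open>X\<close>
  is.\<close>

lemma length_X: "length X \<le> m"
  using card_mono[OF _ X(2)] distinct_card[OF X(1)] by simp

text \<open>The numbers depend on the order in which rows are met, so only their existence is
  stated. All that matters is which of them coincide, and \<open>ids\<close> yields exactly the
  equivalences that \<open>valid_iff_orderable\<close> asks for.\<close>

lemma number_rows:
  "\<exists>s. halts (WhileNeq 6 0 number_row) (init_state r X A B)
       (length r * (m * (cost descend + 1) + (2 * cost (intern 2) + 9)) + 1) s \<and>
     reg s 0 = Num (length r) \<and> reg s 4 = Num 0 \<and> (\<forall>h\<in>{6..9}. tab s h = (\<lambda>_ _. Num 0)) \<and>
     (\<exists>u v :: nat \<Rightarrow> nat.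
        (\<forall>i<length r. tab s 4 (Num i) (Num 0) = Num (u i) \<and> tab s 5 (Num i) (Num 0) = Num (v i) \<and>
           u i \<noteq> 0 \<and> v i \<noteq> 0) \<and>
        row_graph (length r) u v \<and>
        (valid_II_OC r (set X) A B \<longleftrightarrow> orderable (length r) u v))"
proof -
  define I where "I i s \<longleftrightarrow> ready s \<and> reg s 6 = Num i \<and>
      (\<forall>h\<in>{6..9}. tab s h = (\<lambda>_ _. Num 0)) \<and> (\<forall>j<i. \<exists>k. numbered (tab s) j k)" for i and s :: "'v state"
  let ?t = "2 + (length X * (cost descend + 1) + 1 + (2 * cost (intern 2) + 5))"
  have "\<exists>s. halts (WhileNeq 6 0 number_row) (init_state r X A B) (length r * (?t + 1) + 1) s \<and>
      I (length r) s"
  proof (rule halts_for)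
    show "reg s 6 = Num i \<and> reg s 0 = Num (length r)" if "I i s" for i s
      using that unfolding I_def ready_def by blast
    show "I 0 (init_state r X A B)"
      unfolding I_def ready_def init_state_def ids_def by auto
    fix i s assume I: "I i s" and i: "i < length r"
    have s: "ready s" "reg s 6 = Num i" using I unfolding I_def by auto
    obtain s' where s': "halts number_row s ?t s'" "ready s'" "reg s' 6 = Num (Suc i)"
        "extends (tab s) (tab s')" "\<forall>h. h \<notin> {2, 3, 4, 5} \<longrightarrow> tab s' h = tab s h"
        "\<forall>j. j \<noteq> i \<longrightarrow> tab s' 4 (Num j) = tab s 4 (Num j) \<and> tab s' 5 (Num j) = tab s 5 (Num j)"
        "\<exists>k. numbered (tab s') i k"
      using number_row[OF s i] by blast
    have "\<exists>k. numbered (tab s') j k" if "j < Suc i" for j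
    proof (cases "j = i")
      case False
      then have "j < i" using that by simp
      then obtain k where "numbered (tab s) j k" using I unfolding I_def by blast
      then have "numbered (tab s') j k"
        by (rule numbered_extends[OF _ s'(4)]) (use s'(6) False in simp_all)
      then show ?thesis ..
    qed (use s'(7) in simp)
    moreover have "\<forall>h\<in>{6..9}. tab s' h = (\<lambda>_ _. Num 0)"
      using I s'(5) unfolding I_def by simp
    ultimately show "\<exists>s'. halts number_row s ?t s' \<and> I (Suc i) s'"
      using s'(1-3) unfolding I_def by blast
  qed
  then obtain s where s: "halts (WhileNeq 6 0 number_row) (init_state r X A B) (length r * (?t + 1) + 1) s"
    and I: "I (length r) s" by blast
  have "length X * (cost descend + 1) \<le> m * (cost descend + 1)"
    using length_X by (rule mult_le_mono1)
  \<comment> \<open>The 9 collects 2 + 1 + 5 from \<open>number_row\<close> and 1 for the loop test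
    of each row.\<close>
  then have "length r * (?t + 1) \<le> length r * (m * (cost descend + 1) + (2 * cost (intern 2) + 9))"
    by (intro mult_le_mono2) simp
  then have halts: "halts (WhileNeq 6 0 number_row) (init_state r X A B)
      (length r * (m * (cost descend + 1) + (2 * cost (intern 2) + 9)) + 1) s"
    by (intro halts_mono[OF s]) simp
  have rdy: "ready s" using I unfolding I_def by blast
  obtain c where c: "ids (tab s) c" using rdy unfolding ready_def by blast
  have "\<forall>i<length r. \<exists>k. numbered (tab s) i k" using I unfolding I_def by blast
  then obtain k where k: "\<And>i. i < length r \<Longrightarrow> numbered (tab s) i (k i)" by metis
  have "\<exists>a. k i = Num a" if "i < length r" for i
    using k[OF that] trace_Num[OF c] unfolding numbered_def by blast
  then obtain g where g: "\<And>i. i < length r \<Longrightarrow> k i = Num (g i)" by metis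
  have "\<exists>a. tab s 2 (k i) (Val (val r A i)) = Num a" for i
    using ids_Num[OF c] by blast
  then obtain u where u: "\<And>i. tab s 2 (k i) (Val (val r A i)) = Num (u i)" by metis
  have "\<exists>a. tab s 3 (k i) (Val (val r B i)) = Num a" for i
    using ids_Num[OF c] by blast
  then obtain v where v: "\<And>i. tab s 3 (k i) (Val (val r B i)) = Num (v i)" by metis
  have nz: "u i \<noteq> 0" "v i \<noteq> 0" if "i < length r" for i
    using k[OF that] u v unfolding numbered_def by auto
  have cells: "tab s 4 (Num i) (Num 0) = Num (u i)" "tab s 5 (Num i) (Num 0) = Num (v i)"
    if "i < length r" for i
    using k[OF that] u v unfolding numbered_def by auto
  have bip: "u i \<noteq> v j" if "i < length r" "j < length r" for i j
    using ids_inj[OF c, of 2 3 "k i" "Val (val r A i)" "k j" "Val (val r B j)"] u v nz(1)[OF that(1)]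
    by auto
  have gk: "g i = g j \<longleftrightarrow> k i = k j" if "i < length r" "j < length r" for i j
    using g that by simp
  have "g i = g j \<longleftrightarrow> (\<forall>C\<in>set X. val r C i = val r C j)" if "i < length r" "j < length r" for i j
  proof -
    \<comment> \<open>The leaf of the trie identifies the group. For empty \<open>X\<close> every
      row stays at the root, which gives a single group.\<close>
    have "k i = k j \<longleftrightarrow> row_key i = row_key j"
      by (rule trace_inj[OF c]) (use k that in \<open>auto simp: numbered_def row_key_def\<close>)
    then show ?thesis using gk[OF that] by (simp add: row_key_def)
  qed
  moreover have "u i = u j \<longleftrightarrow> g i = g j \<and> val r A i = val r A j"
    if "i < length r" "j < length r" for i j
    using ids_inj[OF c, of 2 2 "k i" "Val (val r A i)" "k j" "Val (val r A j)"]
      u[of i] u[of j] nz(1)[OF that(1)] gk[OF that] by auto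
  moreover have "v i = v j \<longleftrightarrow> g i = g j \<and> val r B i = val r B j"
    if "i < length r" "j < length r" for i j
    using ids_inj[OF c, of 3 3 "k i" "Val (val r B i)" "k j" "Val (val r B j)"]
      v[of i] v[of j] nz(2)[OF that(1)] gk[OF that] by auto
  ultimately have "valid_II_OC r (set X) A B \<longleftrightarrow> orderable (length r) u v"
    by (rule valid_iff_orderable)
  moreover have "row_graph (length r) u v" by unfold_locales (rule bip)
  moreover have "reg s 0 = Num (length r)" "reg s 4 = Num 0" using rdy unfolding ready_def by auto
  moreover have "\<forall>h\<in>{6..9}. tab s h = (\<lambda>_ _. Num 0)" using I unfolding I_def by blast
  ultimately show ?thesis using halts nz cells by blast
qed

end

section \<open>Flagging the branching vertices\<close>

definition mark :: "nat \<Rightarrow> nat \<Rightarrow> com" where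
  "mark a b = Get 14 6 a 4 ;;
     IfEq 14 4 (Put 6 a 4 b) (IfEq 14 b (Copy 4 4) (Put 7 a 4 5))"

text \<open>\<open>D\<close> is the set of pairs (vertex, neighbour) seen so far.\<close>

definition marked :: "(nat \<times> nat) set \<Rightarrow> (nat \<Rightarrow> 'v wrd \<Rightarrow> 'v wrd \<Rightarrow> 'v wrd) \<Rightarrow> bool" where
  "marked D T \<longleftrightarrow> (\<forall>w.
     D `` {w} = {} \<and> T 6 (Num w) (Num 0) = Num 0 \<and> T 7 (Num w) (Num 0) = Num 0 \<or>
     (\<exists>b. b \<in> D `` {w} \<and> T 6 (Num w) (Num 0) = Num b \<and>
        T 7 (Num w) (Num 0) = Num (if D `` {w} = {b} then 0 else 1)))"

text \<open>One remembered neighbour is enough to recognise a second one: a flag is raised when the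
  incoming neighbour differs from it. As neighbours are nonzero, an entry \<open>Num 0\<close> in
  table 6 means that none has been seen.\<close>

lemma ev_mark:
  assumes D: "marked D (tab s)" "0 \<notin> Range D"
    and x: "x \<noteq> 14" "reg s x = Num a" and y: "y \<noteq> 14" "reg s y = Num b" "b \<noteq> 0"
    and c: "reg s 4 = Num 0" "reg s 5 = Num 1"
  defines "s' \<equiv> ev (mark x y) s"
  shows "marked (insert (a, b) D) (tab s')" "\<And>z. z \<noteq> 14 \<Longrightarrow> reg s' z = reg s z"
    "\<And>h. h \<noteq> 6 \<Longrightarrow> h \<noteq> 7 \<Longrightarrow> tab s' h = tab s h"
proof -
  have ins: "insert (a, b) D `` {w} = (if w = a then insert b (D `` {a}) else D `` {w})" for w
    by auto
  let ?a = "tab s 6 (Num a) (Num 0)"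
  have Da: "D `` {a} = {} \<and> ?a = Num 0 \<and> tab s 7 (Num a) (Num 0) = Num 0 \<or>
     (\<exists>b. b \<in> D `` {a} \<and> ?a = Num b \<and>
        tab s 7 (Num a) (Num 0) = Num (if D `` {a} = {b} then 0 else 1))"
    using D(1) unfolding marked_def by blast
  have upd: "marked (insert (a, b) D) T"
    if "\<And>w. w \<noteq> a \<Longrightarrow> T 6 (Num w) (Num 0) = tab s 6 (Num w) (Num 0)"
      "\<And>w. w \<noteq> a \<Longrightarrow> T 7 (Num w) (Num 0) = tab s 7 (Num w) (Num 0)"
      "\<exists>d. d \<in> insert b (D `` {a}) \<and> T 6 (Num a) (Num 0) = Num d \<and>
        T 7 (Num a) (Num 0) = Num (if insert b (D `` {a}) = {d} then 0 else 1)" for T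
    unfolding marked_def
  proof
    fix w
    show "insert (a, b) D `` {w} = {} \<and> T 6 (Num w) (Num 0) = Num 0 \<and> T 7 (Num w) (Num 0) = Num 0 \<or>
     (\<exists>d. d \<in> insert (a, b) D `` {w} \<and> T 6 (Num w) (Num 0) = Num d \<and>
        T 7 (Num w) (Num 0) = Num (if insert (a, b) D `` {w} = {d} then 0 else 1))"
    proof (cases "w = a")
      case True
      then show ?thesis using that(3) unfolding ins by simp
    next
      case False
      then show ?thesis
        using D(1)[unfolded marked_def, rule_format, of w] that(1,2) unfolding ins by simp
    qed
  qed
  consider "?a = Num 0" | "?a = Num b" | "?a \<noteq> Num 0" "?a \<noteq> Num b" by blast
  then have "marked (insert (a, b) D) (tab s') \<and> (\<forall>z. z \<noteq> 14 \<longrightarrow> reg s' z = reg s z) \<and>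
    (\<forall>h. h \<noteq> 6 \<longrightarrow> h \<noteq> 7 \<longrightarrow> tab s' h = tab s h)"
  proof cases
    case 1
    have e: "D `` {a} = {}" "tab s 7 (Num a) (Num 0) = Num 0"
      using Da 1 D(2) by auto
    have t: "tab s' = (tab s)(6 := (tab s 6)(Num a := (tab s 6 (Num a))(Num 0 := Num b)))"
      using 1 x y c by (simp add: s'_def mark_def)
    have "marked (insert (a, b) D) (tab s')" by (rule upd) (simp_all add: t e)
    moreover have "reg s' z = reg s z" if "z \<noteq> 14" for z
      using 1 x y c that by (simp add: s'_def mark_def)
    ultimately show ?thesis by (simp add: t)
  next
    case 2
    have e: "b \<in> D `` {a}" "tab s 7 (Num a) (Num 0) = Num (if D `` {a} = {b} then 0 else 1)"
      using Da 2 y(3) by auto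
    have t: "tab s' = tab s"
      using 2 x y c by (simp add: s'_def mark_def)
    have "insert b (D `` {a}) = D `` {a}" using e(1) by blast
    then have "marked (insert (a, b) D) (tab s')"
      using e 2 by (intro upd) (simp_all add: t)
    moreover have "reg s' z = reg s z" if "z \<noteq> 14" for z
      using 2 x y c that by (simp add: s'_def mark_def)
    ultimately show ?thesis by (simp add: t)
  next
    case 3
    obtain d where d: "d \<in> D `` {a}" "?a = Num d" using Da 3(1) by blast
    then have "insert b (D `` {a}) \<noteq> {d}" using 3(2) by auto
    have t: "tab s' = (tab s)(7 := (tab s 7)(Num a := (tab s 7 (Num a))(Num 0 := Num 1)))"
      using 3 x y c by (simp add: s'_def mark_def)
    have "marked (insert (a, b) D) (tab s')"
      by (rule upd) (use d \<open>insert b (D `` {a}) \<noteq> {d}\<close> in \<open>simp_all add: t\<close>)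
    moreover have "reg s' z = reg s z" if "z \<noteq> 14" for z
      using 3 x y c that by (simp add: s'_def mark_def)
    ultimately show ?thesis by (simp add: t)
  qed
  then show "marked (insert (a, b) D) (tab s')" "\<And>z. z \<noteq> 14 \<Longrightarrow> reg s' z = reg s z"
    "\<And>h. h \<noteq> 6 \<Longrightarrow> h \<noteq> 7 \<Longrightarrow> tab s' h = tab s h"
    by blast+
qed

text \<open>The same pass prepares the linking phase: writing each vertex into its own entry of
  table 9 makes it a one-vertex path.\<close>

definition mark_row :: com where
  "mark_row = (Get 12 4 6 4 ;; Get 13 5 6 4 ;; Put 9 12 4 12 ;; Put 9 13 4 13) ;;
     mark 12 13 ;; mark 13 12 ;; Inc 6"

text \<open>A conflict does not stop the loop; it clears register 16, which no later row sets again.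
  The last four writes follow the order of updates in \<open>path_system_link\<close>.\<close>

definition link_row :: com where
  "link_row = (Get 12 4 6 4 ;; Get 13 5 6 4) ;;
     Get 14 7 12 4 ;; Get 15 7 13 4 ;;
     IfEq 14 4 (Inc 6) (IfEq 15 4 (Inc 6) (
       Get 14 8 12 13 ;;
       IfEq 14 4
         (Put 8 12 13 5 ;; Get 14 9 12 4 ;; Get 15 9 13 4 ;;
          IfEq 14 4 (Const 16 0) (IfEq 15 4 (Const 16 0) (IfEq 14 13 (Const 16 0)
            (Put 9 12 4 4 ;; Put 9 13 4 4 ;; Put 9 14 4 15 ;; Put 9 15 4 14))) ;;
          Inc 6)
         (Inc 6)))"

text \<open>The number 0 is reserved: it means no neighbour in table 6 and an inner vertex in table
  9.\<close>

locale numbered_graph = row_graph +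
  assumes nonzero: "x < n \<Longrightarrow> u x \<noteq> 0" "x < n \<Longrightarrow> v x \<noteq> 0"
begin

definition loaded :: "'v state \<Rightarrow> bool" where
  "loaded s \<longleftrightarrow> reg s 0 = Num n \<and> reg s 4 = Num 0 \<and> reg s 5 = Num 1 \<and>
     (\<forall>i<n. tab s 4 (Num i) (Num 0) = Num (u i) \<and> tab s 5 (Num i) (Num 0) = Num (v i))"

lemma loaded_cong:
  assumes "loaded s" "reg s' 0 = reg s 0" "reg s' 4 = reg s 4" "reg s' 5 = reg s 5"
    "tab s' 4 = tab s 4" "tab s' 5 = tab s 5"
  shows "loaded s'"
  using assms unfolding loaded_def by simp

definition nbrs :: "nat \<Rightarrow> (nat \<times> nat) set" where
  "nbrs i = {(a, b). \<exists>x<i. (a = u x \<and> b = v x) \<or> (a = v x \<and> b = u x)}"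

lemma nbrs_Suc: "nbrs (Suc i) = insert (v i, u i) (insert (u i, v i) (nbrs i))"
  by (auto simp: nbrs_def less_Suc_eq)

lemma branching_iff_nbrs:
  "branching w \<longleftrightarrow> (\<exists>b b'. b \<noteq> b' \<and> (w, b) \<in> nbrs n \<and> (w, b') \<in> nbrs n)"
proof -
  have e: "(w, b) \<in> nbrs n \<longleftrightarrow> (\<exists>x<n. edge x = {w, b})" for b
    unfolding nbrs_def edge_def by (auto simp: doubleton_eq_iff)
  show ?thesis
  proof
    assume "branching w"
    then obtain x y where xy: "x < n" "y < n" "w \<in> edge x" "w \<in> edge y" "edge x \<noteq> edge y"
      unfolding branching_def by blast
    then obtain b b' where b: "edge x = {w, b}" "edge y = {w, b'}"
      unfolding edge_def by (metis insertE insert_commute singletonD)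
    then have "b \<noteq> b'" using xy(5) by auto
    then show "\<exists>b b'. b \<noteq> b' \<and> (w, b) \<in> nbrs n \<and> (w, b') \<in> nbrs n"
      unfolding e using b xy(1,2) by blast
  next
    assume "\<exists>b b'. b \<noteq> b' \<and> (w, b) \<in> nbrs n \<and> (w, b') \<in> nbrs n"
    then obtain b b' x y where "b \<noteq> b'" "x < n" "edge x = {w, b}" "y < n" "edge y = {w, b'}"
      unfolding e by blast
    moreover then have "edge x \<noteq> edge y" by (auto simp: doubleton_eq_iff)
    ultimately show "branching w" unfolding branching_def by blast
  qed
qed

definition flagged :: "'v state \<Rightarrow> bool" where
  "flagged s \<longleftrightarrow> (\<forall>x<n. (tab s 7 (Num (u x)) (Num 0) \<noteq> Num 0 \<longleftrightarrow> branching (u x)) \<and>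
     (tab s 7 (Num (v x)) (Num 0) \<noteq> Num 0 \<longleftrightarrow> branching (v x)))"

lemma marked_branching:
  assumes "marked (nbrs n) T"
  shows "T 7 (Num w) (Num 0) \<noteq> Num 0 \<longleftrightarrow> branching w"
proof -
  have "nbrs n `` {w} = {} \<and> T 7 (Num w) (Num 0) = Num 0 \<or>
     (\<exists>b. b \<in> nbrs n `` {w} \<and> T 7 (Num w) (Num 0) = Num (if nbrs n `` {w} = {b} then 0 else 1))"
    using assms unfolding marked_def by blast
  then show ?thesis
  proof
    assume "nbrs n `` {w} = {} \<and> T 7 (Num w) (Num 0) = Num 0"
    then show ?thesis unfolding branching_iff_nbrs by auto
  next
    assume "\<exists>b. b \<in> nbrs n `` {w} \<and> T 7 (Num w) (Num 0) = Num (if nbrs n `` {w} = {b} then 0 else 1)"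
    then obtain b where b: "(w, b) \<in> nbrs n"
      "T 7 (Num w) (Num 0) = Num (if nbrs n `` {w} = {b} then 0 else 1)" by blast
    have "nbrs n `` {w} = {b} \<longleftrightarrow> \<not> branching w"
    proof -
      have "nbrs n `` {w} = {b} \<longleftrightarrow> (\<forall>c. (w, c) \<in> nbrs n \<longrightarrow> c = b)" using b(1) by auto
      then show ?thesis unfolding branching_iff_nbrs using b(1) by metis
    qed
    then show ?thesis using b(2) by simp
  qed
qed

lemma mark_rows:
  assumes s: "loaded s" "reg s 6 = Num 0" and z: "\<And>h. h \<in> {6..9} \<Longrightarrow> tab s h = (\<lambda>_ _. Num 0)"
  shows "\<exists>s'. halts (WhileNeq 6 0 mark_row) s (n * (cost mark_row + 1) + 1) s' \<and>
    loaded s' \<and> flagged s' \<and> tab s' 8 = (\<lambda>_ _. Num 0) \<and>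
    (\<forall>x<n. \<forall>w\<in>edge x. tab s' 9 (Num w) (Num 0) = Num w)"
proof -
  define I where "I i s \<longleftrightarrow> loaded s \<and> reg s 6 = Num i \<and> tab s 8 = (\<lambda>_ _. Num 0) \<and>
      marked (nbrs i) (tab s) \<and> (\<forall>x<i. \<forall>w\<in>edge x. tab s 9 (Num w) (Num 0) = Num w)"
    for i and s :: "'a state"
  have "\<exists>s'. halts (WhileNeq 6 0 mark_row) s (n * (cost mark_row + 1) + 1) s' \<and> I n s'"
  proof (rule halts_for)
    show "reg s 6 = Num i \<and> reg s 0 = Num n" if "I i s" for i s
      using that unfolding I_def loaded_def by blast
    show "I 0 s" using s z by (simp add: I_def marked_def nbrs_def)
    fix i s0 assume I: "I i s0" and i: "i < n"
    define s1 where "s1 = ev (Get 12 4 6 4 ;; Get 13 5 6 4 ;; Put 9 12 4 12 ;; Put 9 13 4 13) s0"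
    define s2 where "s2 = ev (mark 12 13) s1"
    define s3 where "s3 = ev (mark 13 12) s2"
    define s4 where "s4 = ev (Inc 6) s3"
    have s0: "reg s0 4 = Num 0" "reg s0 5 = Num 1" "reg s0 6 = Num i"
        "tab s0 4 (Num i) (Num 0) = Num (u i)" "tab s0 5 (Num i) (Num 0) = Num (v i)"
      using I i unfolding I_def loaded_def by auto
    have t1: "tab s1 = (tab s0)(9 := (tab s0 9)
        (Num (u i) := (tab s0 9 (Num (u i)))(Num 0 := Num (u i)),
         Num (v i) := (tab s0 9 (Num (v i)))(Num 0 := Num (v i))))"
      and r1: "reg s1 = (reg s0)(12 := Num (u i), 13 := Num (v i))"
      using s0 bip[OF i i] by (simp_all add: s1_def)
    have nz: "0 \<notin> Range (nbrs i)"
      using nonzero i unfolding nbrs_def by (auto simp: Range_iff)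
    have m1: "marked (nbrs i) (tab s1)" using I unfolding I_def marked_def by (simp add: t1)
    have n14: "(12::nat) \<noteq> 14" "(13::nat) \<noteq> 14" by simp_all
    have p1: "reg s1 12 = Num (u i)" "reg s1 13 = Num (v i)" "reg s1 4 = Num 0" "reg s1 5 = Num 1"
      by (simp_all add: r1 s0)
    note M2 = ev_mark[OF m1 nz n14(1) p1(1) n14(2) p1(2) nonzero(2)[OF i] p1(3,4), folded s2_def]
    have nz2: "0 \<notin> Range (insert (u i, v i) (nbrs i))"
      using nz nonzero(2)[OF i] by auto
    have p2: "reg s2 12 = Num (u i)" "reg s2 13 = Num (v i)" "reg s2 4 = Num 0" "reg s2 5 = Num 1"
      by (simp_all add: M2(2) p1)
    note M3 = ev_mark[OF M2(1) nz2 n14(2) p2(2) n14(1) p2(1) nonzero(1)[OF i] p2(3,4), folded s3_def]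
    have "loaded s4"
    proof (rule loaded_cong)
      show "loaded s0" using I unfolding I_def by blast
    qed (simp_all add: s4_def M3(2,3) M2(2,3) r1 t1)
    moreover have "reg s4 6 = Num (Suc i)" by (simp add: s4_def M3 M2 r1 s0)
    moreover have "tab s4 8 = (\<lambda>_ _. Num 0)" using I by (simp add: s4_def M3 M2 t1 I_def)
    moreover have "marked (nbrs (Suc i)) (tab s4)" using M3(1) by (simp add: nbrs_Suc s4_def)
    moreover have "tab s4 9 (Num w) (Num 0) = Num w" if "x < Suc i" "w \<in> edge x" for x w
    proof -
      have "tab s4 9 = tab s1 9" by (simp add: s4_def M3 M2)
      moreover have "tab s1 9 (Num w) (Num 0) = Num w"
      proof (cases "w = u i \<or> w = v i")
        case False
        then have "x < i" using that by (auto simp: less_Suc_eq edge_def)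
        then have "tab s0 9 (Num w) (Num 0) = Num w" using I that(2) unfolding I_def by blast
        then show ?thesis using False by (simp add: t1)
      qed (auto simp: t1)
      ultimately show ?thesis by simp
    qed
    ultimately have "I (Suc i) s4" unfolding I_def by blast
    moreover have "ev mark_row s0 = s4" by (simp add: mark_row_def s4_def s3_def s2_def s1_def)
    moreover have "loop_free mark_row" by (simp add: mark_row_def mark_def)
    ultimately show "\<exists>s'. halts mark_row s0 (cost mark_row) s' \<and> I (Suc i) s'"
      using halts_ev by metis
  qed
  then obtain s' where s': "halts (WhileNeq 6 0 mark_row) s (n * (cost mark_row + 1) + 1) s'" "I n s'"
    by blast
  then have "flagged s'" unfolding flagged_def I_def using marked_branching by blast
  then show ?thesis using s' unfolding I_def by blast
qed

section \<open>Adding the core edges to a system of paths\<close>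

definition V :: "nat set" where
  "V = \<Union> (edge ` {..<n})"

definition core_edges :: "nat \<Rightarrow> nat set set" where
  "core_edges i = edge ` {x. x < i \<and> core x}"

lemma core_edges_Suc:
  "core_edges (Suc i) = (if core i then insert (edge i) (core_edges i) else core_edges i)"
  by (auto simp: core_edges_def less_Suc_eq)

lemma V_props: "0 \<notin> V" "x < n \<Longrightarrow> u x \<in> V" "x < n \<Longrightarrow> v x \<in> V" "finite V"
  unfolding V_def edge_def using nonzero by auto

text \<open>The content of tables 8 and 9 while no conflict has been found.\<close>

definition linked :: "nat \<Rightarrow> (nat \<Rightarrow> 'v wrd \<Rightarrow> 'v wrd \<Rightarrow> 'v wrd) \<Rightarrow> bool" where
  "linked i T \<longleftrightarrow>
     (\<forall>a b. T 8 (Num a) (Num b) \<noteq> Num 0 \<longleftrightarrow> (\<exists>x<i. core x \<and> u x = a \<and> v x = b)) \<and>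
     (\<exists>oth Ps. (\<forall>w\<in>V. T 9 (Num w) (Num 0) = Num (oth w)) \<and>
        path_system V (core_edges i) oth Ps)"

text \<open>After a conflict nothing is claimed about tables 8 and 9, which may then hold anything;
  the refutation itself does not depend on \<open>i\<close> and stays valid.\<close>

definition state_ok :: "nat \<Rightarrow> 'v state \<Rightarrow> bool" where
  "state_ok i s \<longleftrightarrow>
     reg s 16 = Num 0 \<and> \<not> orderable n u v \<or> reg s 16 = Num 1 \<and> linked i (tab s)"

text \<open>A row that is not core, or whose edge is already present, leaves the paths alone.
  Otherwise each way of failing the three tests on \<open>oth\<close> comes with a refutation, and
  passing them is the hypothesis of \<open>path_system_link\<close>.\<close>

lemma link_row_step:
  assumes s: "loaded s" "flagged s" "reg s 6 = Num i" and i: "i < n" and ok: "state_ok i s"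
  defines "s' \<equiv> ev link_row s"
  shows "loaded s'" "flagged s'" "reg s' 6 = Num (Suc i)" "state_ok (Suc i) s'"
proof -
  have c: "reg s 4 = Num 0" "reg s 5 = Num 1" "reg s 6 = Num i"
    "tab s 4 (Num i) (Num 0) = Num (u i)" "tab s 5 (Num i) (Num 0) = Num (v i)"
    using s i unfolding loaded_def by auto
  have br: "tab s 7 (Num (u i)) (Num 0) \<noteq> Num 0 \<longleftrightarrow> branching (u i)"
    "tab s 7 (Num (v i)) (Num 0) \<noteq> Num 0 \<longleftrightarrow> branching (v i)"
    using s(2) i unfolding flagged_def by auto
  let ?seen = "tab s 8 (Num (u i)) (Num (v i))"
  let ?p = "tab s 9 (Num (u i)) (Num 0)" and ?q = "tab s 9 (Num (v i)) (Num 0)"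
  let ?T8 = "(tab s)(8 := (tab s 8)(Num (u i) := (tab s 8 (Num (u i)))(Num (v i) := Num 1)))"
  let ?t9 = "(tab s 9)(Num (u i) := (tab s 9 (Num (u i)))(Num 0 := Num 0))"
  note uv = bip[OF i i]
  \<comment> \<open>True in every branch of the code, hence also after a conflict, when tables 8 and
    9 are unknown.\<close>
  have "(\<forall>z. z \<notin> {6, 12, 13, 14, 15, 16} \<longrightarrow> reg s' z = reg s z) \<and> reg s' 6 = Num (Suc i) \<and>
      (\<forall>h. h \<noteq> 8 \<longrightarrow> h \<noteq> 9 \<longrightarrow> tab s' h = tab s h)"
    unfolding s'_def link_row_def using c by simp
  then have frame: "\<And>z. z \<notin> {6, 12, 13, 14, 15, 16} \<Longrightarrow> reg s' z = reg s z" "reg s' 6 = Num (Suc i)"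
      "\<And>h. h \<noteq> 8 \<Longrightarrow> h \<noteq> 9 \<Longrightarrow> tab s' h = tab s h"
    by blast+
  have flag: "reg s' 16 = Num 0 \<or> reg s' 16 = reg s 16"
    unfolding s'_def link_row_def using c by simp
  show "loaded s'" by (rule loaded_cong[OF s(1)]) (simp_all add: frame)
  show "flagged s'" using s(2) unfolding flagged_def by (simp add: frame)
  show "reg s' 6 = Num (Suc i)" by (fact frame(2))
  show "state_ok (Suc i) s'"
  proof (cases "reg s 16 = Num 0")
    case True
    then have "\<not> orderable n u v" "reg s' 16 = Num 0" using ok flag unfolding state_ok_def by auto
    then show ?thesis unfolding state_ok_def by simp
  next
    case False
    then have ok': "reg s 16 = Num 1" "linked i (tab s)" using ok unfolding state_ok_def by auto
    have seen: "tab s 8 (Num a) (Num b) \<noteq> Num 0 \<longleftrightarrow> (\<exists>x<i. core x \<and> u x = a \<and> v x = b)" for a b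
      using ok'(2) unfolding linked_def by blast
    obtain oth Ps where oth: "\<And>w. w \<in> V \<Longrightarrow> tab s 9 (Num w) (Num 0) = Num (oth w)"
      and sys: "path_system V (core_edges i) oth Ps"
      using ok'(2) unfolding linked_def by blast
    note Vi = V_props(2,3)[OF i]
    have pq: "?p = Num (oth (u i))" "?q = Num (oth (v i))" using oth Vi by auto
    have F: "\<exists>y<n. core y \<and> edge y = e" if "e \<in> core_edges i" for e
      using that i less_trans unfolding core_edges_def by blast
    have seen_i: "?seen \<noteq> Num 0 \<longleftrightarrow> edge i \<in> core_edges i" if "core i"
    proof
      assume "?seen \<noteq> Num 0"
      then obtain x where x: "x < i" "core x" "u x = u i" "v x = v i" unfolding seen by blast
      then have "edge i = edge x" by (simp add: edge_def)
      then show "edge i \<in> core_edges i" using x(1,2) unfolding core_edges_def by blast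
    next
      assume "edge i \<in> core_edges i"
      then obtain x where "x < i" "core x" "edge i = edge x" unfolding core_edges_def by blast
      then show "?seen \<noteq> Num 0" unfolding seen using edge_eq_iff[of i x] i by auto
    qed
    have unchanged: "state_ok (Suc i) s'"
      if "tab s' 8 = tab s 8" "tab s' 9 = tab s 9" "reg s' 16 = reg s 16"
        "core i \<Longrightarrow> edge i \<in> core_edges i"
    proof -
      have "core_edges (Suc i) = core_edges i" using that(4) by (auto simp: core_edges_Suc)
      moreover have "(\<exists>x<Suc i. core x \<and> u x = a \<and> v x = b) \<longleftrightarrow> (\<exists>x<i. core x \<and> u x = a \<and> v x = b)" for a b
      proof -
        have "\<exists>x<i. core x \<and> u x = u i \<and> v x = v i" if "core i"
          using seen seen_i that \<open>core i \<Longrightarrow> edge i \<in> core_edges i\<close> by blast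
        then show ?thesis by (auto simp: less_Suc_eq)
      qed
      ultimately show ?thesis
        using ok' that(1-3) unfolding state_ok_def linked_def by simp
    qed
    show ?thesis
    proof (cases "core i")
      case False
      have "tab s 7 (Num (u i)) (Num 0) = Num 0 \<or> tab s 7 (Num (v i)) (Num 0) = Num 0"
        using False br unfolding core_def by blast
      then have "tab s' = tab s" "reg s' 16 = reg s 16"
        unfolding s'_def link_row_def using c by auto
      then show ?thesis using unchanged False by simp
    next
      case True
      then have b: "tab s 7 (Num (u i)) (Num 0) \<noteq> Num 0" "tab s 7 (Num (v i)) (Num 0) \<noteq> Num 0"
        using br unfolding core_def by auto
      show ?thesis
      proof (cases "?seen = Num 0")
        case False
        then have "tab s' = tab s" "reg s' 16 = reg s 16"
          unfolding s'_def link_row_def using c b by auto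
        then show ?thesis using unchanged False seen_i True by simp
      next
        case new: True
        then have e: "edge i \<notin> core_edges i" using seen_i True by blast
        have uV: "u i \<in> edge i" "v i \<in> edge i" by (auto simp: edge_def)
        \<comment> \<open>A zero means that the edge meets an inner vertex;
          \<open>oth (u i) = v i\<close> means that it closes a cycle.\<close>
        have conflict: "\<not> orderable n u v"
          if "oth (u i) = 0 \<or> oth (v i) = 0 \<or> oth (u i) = v i"
          using that inner_vertex_not_orderable[OF sys V_props(1) F i True e uV(1) Vi(1)]
            inner_vertex_not_orderable[OF sys V_props(1) F i True e uV(2) Vi(2)]
            closing_edge_not_orderable[OF sys V_props(1) F i e Vi] by blast
        show ?thesis
        proof (cases "oth (u i) = 0 \<or> oth (v i) = 0 \<or> oth (u i) = v i")
          case bad: True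
          have "reg s' 16 = Num 0"
            unfolding s'_def link_row_def using c b new pq bad by auto
          then show ?thesis using conflict bad unfolding state_ok_def by blast
        next
          case False
          then have p0: "oth (u i) \<noteq> 0" and q0: "oth (v i) \<noteq> 0" and pv: "oth (u i) \<noteq> v i"
            by auto
          let ?oth = "oth(u i := 0, v i := 0, oth (u i) := oth (v i), oth (v i) := oth (u i))"
          have r16: "reg s' 16 = Num 1"
            unfolding s'_def link_row_def using c b new pq p0 q0 pv ok'(1) by simp
          have t8: "tab s' 8 = (tab s 8)(Num (u i) := (tab s 8 (Num (u i)))(Num (v i) := Num 1))"
            unfolding s'_def link_row_def using c b new pq p0 q0 pv by simp
          have t9: "tab s' 9 (Num w) (Num 0) = Num (?oth w)" if "w \<in> V" for w
            unfolding s'_def link_row_def using c b new pq p0 q0 pv oth[OF that] by simp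
          have "edge i = {u i, v i}" by (simp add: edge_def)
          then have "\<exists>Ps'. path_system V (core_edges (Suc i)) ?oth Ps'"
            using path_system_link[OF sys Vi uv p0 q0 pv] True by (simp add: core_edges_Suc)
          moreover have "tab s' 8 (Num a) (Num b) \<noteq> Num 0 \<longleftrightarrow> (\<exists>x<Suc i. core x \<and> u x = a \<and> v x = b)" for a b
            using seen[of a b] True by (auto simp: t8 less_Suc_eq)
          ultimately have "linked (Suc i) (tab s')" unfolding linked_def using t9 by blast
          then show ?thesis using r16 unfolding state_ok_def by blast
        qed
      qed
    qed
  qed
qed

text \<open>If the verdict survives the loop, every core edge is a link of the final paths, and
  these provide an order; a cleared verdict already carries its refutation.\<close>

lemma link_rows:
  assumes s: "loaded s" "flagged s" "reg s 6 = Num 0" "reg s 16 = Num 1"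
    and t8: "tab s 8 = (\<lambda>_ _. Num 0)"
    and t9: "\<And>x w. x < n \<Longrightarrow> w \<in> edge x \<Longrightarrow> tab s 9 (Num w) (Num 0) = Num w"
  shows "\<exists>s'. halts (WhileNeq 6 0 link_row) s (n * (cost link_row + 1) + 1) s' \<and>
    reg s' 16 = Num (if orderable n u v then 1 else 0)"
proof -
  define I where "I i s \<longleftrightarrow> loaded s \<and> flagged s \<and> reg s 6 = Num i \<and> state_ok i s"
    for i and s :: "'a state"
  have "\<exists>s'. halts (WhileNeq 6 0 link_row) s (n * (cost link_row + 1) + 1) s' \<and> I n s'"
  proof (rule halts_for)
    show "reg s 6 = Num i \<and> reg s 0 = Num n" if "I i s" for i s
      using that unfolding I_def loaded_def by blast
    have "path_system V {} (\<lambda>w. w) ((\<lambda>x. [x]) ` V)"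
      by (rule path_system_singletons) (use V_props(4) in auto)
    moreover have "tab s 9 (Num w) (Num 0) = Num w" if "w \<in> V" for w
      using that t9 unfolding V_def by auto
    ultimately have "linked 0 (tab s)"
      unfolding linked_def by (auto simp: t8 core_edges_def)
    then show "I 0 s" using s unfolding I_def state_ok_def by blast
    fix i s0 assume I: "I i s0" and i: "i < n"
    have "loop_free link_row" by (simp add: link_row_def)
    then show "\<exists>s'. halts link_row s0 (cost link_row) s' \<and> I (Suc i) s'"
      using halts_ev link_row_step[of s0 i] I i unfolding I_def by blast
  qed
  then obtain s' where s': "halts (WhileNeq 6 0 link_row) s (n * (cost link_row + 1) + 1) s'"
    "state_ok n s'" unfolding I_def by blast
  have "orderable n u v" if "linked n (tab s')"
  proof -
    obtain oth Ps where "path_system V (core_edges n) oth Ps"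
      using \<open>linked n (tab s')\<close> unfolding linked_def by blast
    then show ?thesis
      by (rule path_system_imp_orderable) (auto simp: V_def core_edges_def)
  qed
  then have "reg s' 16 = Num (if orderable n u v then 1 else 0)"
    using s'(2) unfolding state_ok_def by auto
  then show ?thesis using s'(1) by blast
qed

end

section \<open>The complete program and its linear running time\<close>

definition validate :: com where
  "validate = WhileNeq 6 0 number_row ;; (Const 5 1 ;; Const 6 0) ;; WhileNeq 6 0 mark_row ;;
     (Const 6 0 ;; Const 16 1) ;; WhileNeq 6 0 link_row ;; Copy 0 16"

definition row_cost :: "nat \<Rightarrow> nat" where
  "row_cost m = m * (cost descend + 1) + (2 * cost (intern 2) + 9) + (cost mark_row + 1) +
     (cost link_row + 1)"

lemma (in table_input) validate_correct:
  "\<exists>s. halts validate (init_state r X A B) (length r * row_cost m + 8) s \<and>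
     result s = Num (if valid_II_OC r (set X) A B then 1 else 0)"
proof -
  let ?n = "length r"
  obtain s1 u v where s1: "halts (WhileNeq 6 0 number_row) (init_state r X A B)
       (?n * (m * (cost descend + 1) + (2 * cost (intern 2) + 9)) + 1) s1"
     "reg s1 0 = Num ?n" "reg s1 4 = Num 0" "\<forall>h\<in>{6..9}. tab s1 h = (\<lambda>_ _. Num 0)"
    and uv: "\<And>i. i < ?n \<Longrightarrow> tab s1 4 (Num i) (Num 0) = Num (u i) \<and>
        tab s1 5 (Num i) (Num 0) = Num (v i) \<and> u i \<noteq> 0 \<and> v i \<noteq> 0"
    and graph: "row_graph ?n u v"
    and valid: "valid_II_OC r (set X) A B \<longleftrightarrow> orderable ?n u v"
    using number_rows by blast
  interpret numbered_graph ?n u v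
    using graph uv by (simp add: numbered_graph_def numbered_graph_axioms_def)
  define s2 where "s2 = ev (Const 5 1 ;; Const 6 0) s1"
  have h2: "halts (Const 5 1 ;; Const 6 0) s1 2 s2"
    using halts_ev[of "Const 5 1 ;; Const 6 0" s1] by (simp add: s2_def numeral_2_eq_2)
  have "loaded s2" using s1(2,3) uv by (simp add: loaded_def s2_def)
  moreover have "reg s2 6 = Num 0" by (simp add: s2_def)
  moreover have "tab s2 h = (\<lambda>_ _. Num 0)" if "h \<in> {6..9}" for h
    using s1(4) that by (simp add: s2_def)
  ultimately obtain s3 where s3: "halts (WhileNeq 6 0 mark_row) s2 (?n * (cost mark_row + 1) + 1) s3"
    "loaded s3" "flagged s3" "tab s3 8 = (\<lambda>_ _. Num 0)"
    "\<forall>x<?n. \<forall>w\<in>edge x. tab s3 9 (Num w) (Num 0) = Num w"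
    using mark_rows by blast
  define s4 where "s4 = ev (Const 6 0 ;; Const 16 1) s3"
  have h4: "halts (Const 6 0 ;; Const 16 1) s3 2 s4"
    using halts_ev[of "Const 6 0 ;; Const 16 1" s3] by (simp add: s4_def numeral_2_eq_2)
  have "loaded s4" by (rule loaded_cong[OF s3(2)]) (simp_all add: s4_def)
  moreover have "flagged s4" using s3(3) by (simp add: flagged_def s4_def)
  moreover have "reg s4 6 = Num 0" "reg s4 16 = Num 1" "tab s4 = tab s3" by (simp_all add: s4_def)
  ultimately obtain s5 where s5: "halts (WhileNeq 6 0 link_row) s4 (?n * (cost link_row + 1) + 1) s5"
    "reg s5 16 = Num (if orderable ?n u v then 1 else 0)"
    using link_rows[of s4] s3(4,5) by auto
  define s6 where "s6 = ev (Copy 0 16) s5"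
  have h6: "halts (Copy 0 16) s5 1 s6" using halts_ev[of "Copy 0 16" s5] by (simp add: s6_def)
  \<comment> \<open>The 8 steps outside the rows are three loop exits and five single
    instructions.\<close>
  have "halts validate (init_state r X A B)
     ((?n * (m * (cost descend + 1) + (2 * cost (intern 2) + 9)) + 1) +
      (2 + ((?n * (cost mark_row + 1) + 1) + (2 + ((?n * (cost link_row + 1) + 1) + 1))))) s6"
    unfolding validate_def
    by (rule halts_Seq[OF s1(1) halts_Seq[OF h2 halts_Seq[OF s3(1)
          halts_Seq[OF h4 halts_Seq[OF s5(1) h6]]]]])
  then have "halts validate (init_state r X A B) (?n * row_cost m + 8) s6"
    by (rule halts_mono) (simp add: row_cost_def distrib_left)
  moreover have "result s6 = Num (if valid_II_OC r (set X) A B then 1 else 0)"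
    by (simp add: result_def s6_def s5(2) valid)
  ultimately show ?thesis by blast
qed

text \<open>From \<open>n = 1\<close> on, \<open>b\<close> is at most \<open>b * n\<close>, so the
  factor \<open>a + b\<close> works.\<close>

lemma linear_bigo: "(\<lambda>n. real (n * a + b)) \<in> O(\<lambda>n. real n)"
proof (rule bigoI)
  show "\<forall>\<^sub>F n in sequentially. norm (real (n * a + b)) \<le> real (a + b) * norm (real n)"
    using eventually_ge_at_top[of "1::nat"]
  proof eventually_elim
    case (elim n)
    then have "n * a + b \<le> (a + b) * n" by (cases n) (auto simp: algebra_simps)
    then show ?case by (metis norm_of_nat of_nat_le_iff of_nat_mult)
  qed
qed

theorem lemma4:
  "\<exists>P :: com. \<forall>m :: nat. \<exists>f :: nat \<Rightarrow> nat.
     (\<lambda>n. real (f n)) \<in> O(\<lambda>n. real n) \<and>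
     (\<forall>(r :: 'v list list) (X :: nat list) (A :: nat) (B :: nat).
        is_table m r \<and> distinct X \<and> set X \<subseteq> {..<m} \<and> A < m \<and> B < m \<longrightarrow>
        (\<exists>t s. exec P (init_state r X A B) t s \<and> t \<le> f (length r) \<and>
               result s = Num (if valid_II_OC r (set X) A B then 1 else 0)))"
proof (rule exI[of _ validate], rule allI, rule exI, intro conjI allI impI)
  fix m
  \<comment> \<open>This instantiates the bound left open by \<open>exI\<close>: it may depend on
    \<open>m\<close>, but not on the table or on \<open>X\<close>, whereas the program was fixed
    before \<open>m\<close>.\<close>
  show "(\<lambda>n. real (n * row_cost m + 8)) \<in> O(\<lambda>n. real n)" by (rule linear_bigo)
  fix r :: "'v list list" and X A B
  assume "is_table m r \<and> distinct X \<and> set X \<subseteq> {..<m} \<and> A < m \<and> B < m"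
  then interpret table_input r X A B m by unfold_locales auto
  show "\<exists>t s. exec validate (init_state r X A B) t s \<and> t \<le> length r * row_cost m + 8 \<and>
      result s = Num (if valid_II_OC r (set X) A B then 1 else 0)"
    using validate_correct unfolding halts_def by blast
qed

end
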